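(* Let $H$ be a group. If $H$ is polycyclic, then $\chi(H)$ is polycyclic; and if $H$ is polycyclic-by-finite, then $\chi(H)$ is polycyclic-by-finite.
   Context: A group is polycyclic-by-finite if it has a normal polycyclic subgroup of finite index. Conventions: $x^{y}=y^{-1}xy$ and $[x,y]=x^{-1}y^{-1}xy$. For a group $H$, let $H^{\psi}$ be an isomorphic copy of $H$ via an isomorphism $\psi: h\mapsto h^{\psi}$. The weak commutativity group is $$\chi(H)=\langle H, H^{\psi}\mid [h,h^{\psi}]=1\ \ \forall h\in H\rangle,$$ i.e. the quotient of the free product $H*H^{\psi}$ by the normal closure of all $[h,h^{\psi}]$, $h\in H$. *)

theory Defs
  imports "HOL-Algebra.Algebra"
begin

section \<open>Polycyclic and polycyclic-by-finite groups\<close>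

text \<open>\<open>polycyclic_seq G H\<close>: the subgroup \<open>H\<close> of \<open>G\<close> has a finite subnormal series
  with cyclic factors.  This is \<^const>\<open>solvable_seq\<close> with cyclic instead of abelian
  factors.\<close>

inductive polycyclic_seq :: "('a, 'b) monoid_scheme \<Rightarrow> 'a set \<Rightarrow> bool"
  for G where
    unity: "polycyclic_seq G {\<one>\<^bsub>G\<^esub>}"
  | extension: "\<lbrakk>polycyclic_seq G K; K \<lhd> G\<lparr>carrier := H\<rparr>; subgroup H G;
                  cyclic_group (G\<lparr>carrier := H\<rparr> Mod K)\<rbrakk> \<Longrightarrow> polycyclic_seq G H"

definition polycyclic :: "('a, 'b) monoid_scheme \<Rightarrow> bool"
  where "polycyclic G \<longleftrightarrow> group G \<and> polycyclic_seq G (carrier G)"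

definition polycyclic_by_finite :: "('a, 'b) monoid_scheme \<Rightarrow> bool"
  where "polycyclic_by_finite G \<longleftrightarrow>
    group G \<and> (\<exists>N. N \<lhd> G \<and> polycyclic (G\<lparr>carrier := N\<rparr>) \<and> finite (rcosets\<^bsub>G\<^esub> N))"


section \<open>Free product of two groups\<close>

text \<open>Elements of the free product are words in the disjoint union of the two carriers,
  modulo the congruence generated by multiplying adjacent letters of the same factor and by
  deleting letters that are the identity of their factor.\<close>

abbreviation fp_words :: "('a, 'm) monoid_scheme \<Rightarrow> ('b, 'n) monoid_scheme \<Rightarrow> ('a + 'b) list set"
  where "fp_words G K \<equiv> lists (carrier G <+> carrier K)"

inductive fp_eq ::
    "('a, 'm) monoid_scheme \<Rightarrow> ('b, 'n) monoid_scheme \<Rightarrow> ('a + 'b) list \<Rightarrow> ('a + 'b) list \<Rightarrow> bool"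
  for G K where
    refl: "u \<in> fp_words G K \<Longrightarrow> fp_eq G K u u"
  | sym: "fp_eq G K u v \<Longrightarrow> fp_eq G K v u"
  | trans: "\<lbrakk>fp_eq G K u v; fp_eq G K v w\<rbrakk> \<Longrightarrow> fp_eq G K u w"
  | multl: "\<lbrakk>u \<in> fp_words G K; v \<in> fp_words G K; x \<in> carrier G; y \<in> carrier G\<rbrakk>
      \<Longrightarrow> fp_eq G K (u @ [Inl x, Inl y] @ v) (u @ [Inl (x \<otimes>\<^bsub>G\<^esub> y)] @ v)"
  | multr: "\<lbrakk>u \<in> fp_words G K; v \<in> fp_words G K; x \<in> carrier K; y \<in> carrier K\<rbrakk>
      \<Longrightarrow> fp_eq G K (u @ [Inr x, Inr y] @ v) (u @ [Inr (x \<otimes>\<^bsub>K\<^esub> y)] @ v)"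
  | onel: "\<lbrakk>u \<in> fp_words G K; v \<in> fp_words G K\<rbrakk> \<Longrightarrow> fp_eq G K (u @ [Inl \<one>\<^bsub>G\<^esub>] @ v) (u @ v)"
  | oner: "\<lbrakk>u \<in> fp_words G K; v \<in> fp_words G K\<rbrakk> \<Longrightarrow> fp_eq G K (u @ [Inr \<one>\<^bsub>K\<^esub>] @ v) (u @ v)"

definition fp_class ::
    "('a, 'm) monoid_scheme \<Rightarrow> ('b, 'n) monoid_scheme \<Rightarrow> ('a + 'b) list \<Rightarrow> ('a + 'b) list set"
  where "fp_class G K w = {v. fp_eq G K w v}"

definition free_product ::
    "('a, 'm) monoid_scheme \<Rightarrow> ('b, 'n) monoid_scheme \<Rightarrow> ('a + 'b) list set monoid"
  where "free_product G K =
    \<lparr>carrier = fp_class G K ` fp_words G K,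
     monoid.mult = (\<lambda>A B. \<Union>u\<in>A. \<Union>v\<in>B. fp_class G K (u @ v)),
     one = fp_class G K []\<rparr>"

definition fp_inl :: "('a, 'm) monoid_scheme \<Rightarrow> ('b, 'n) monoid_scheme \<Rightarrow> 'a \<Rightarrow> ('a + 'b) list set"
  where "fp_inl G K x = fp_class G K [Inl x]"

definition fp_inr :: "('a, 'm) monoid_scheme \<Rightarrow> ('b, 'n) monoid_scheme \<Rightarrow> 'b \<Rightarrow> ('a + 'b) list set"
  where "fp_inr G K y = fp_class G K [Inr y]"


section \<open>The weak commutativity group\<close>

definition group_commutator :: "('a, 'b) monoid_scheme \<Rightarrow> 'a \<Rightarrow> 'a \<Rightarrow> 'a"
  where "group_commutator G x y = inv\<^bsub>G\<^esub> x \<otimes>\<^bsub>G\<^esub> inv\<^bsub>G\<^esub> y \<otimes>\<^bsub>G\<^esub> x \<otimes>\<^bsub>G\<^esub> y"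

definition normal_closure :: "('a, 'b) monoid_scheme \<Rightarrow> 'a set \<Rightarrow> 'a set"
  where "normal_closure G S = \<Inter>{N. N \<lhd> G \<and> S \<subseteq> N}"

text \<open>The isomorphic copy of \<open>H\<close> is the second factor of the free product of \<open>H\<close> with
  itself: \<open>h\<close> and its copy are \<open>fp_inl H H h\<close> and \<open>fp_inr H H h\<close>.\<close>

definition weak_commutators :: "('a, 'b) monoid_scheme \<Rightarrow> ('a + 'a) list set set"
  where "weak_commutators H =
    {group_commutator (free_product H H) (fp_inl H H h) (fp_inr H H h) | h. h \<in> carrier H}"

definition weak_commutativity_group ::
    "('a, 'b) monoid_scheme \<Rightarrow> ('a + 'a) list set set monoid"  ("\<chi>")
  where "\<chi> H = free_product H H Mod normal_closure (free_product H H) (weak_commutators H)"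


section \<open>Basic properties\<close>

lemma fp_eq_words:
  assumes "group G" "group K" "fp_eq G K u v"
  shows "u \<in> fp_words G K \<and> v \<in> fp_words G K"
  using assms(3)
  by induction (use assms(1,2) in \<open>auto simp: group.is_monoid monoid.m_closed\<close>)

lemma fp_eq_append_left:
  assumes "fp_eq G K u v" "w \<in> fp_words G K"
  shows "fp_eq G K (w @ u) (w @ v)"
  using assms(1)
proof induction
  case (refl u) then show ?case using assms(2) by (intro fp_eq.refl) simp
next
  case (sym u v) then show ?case by (blast intro: fp_eq.sym)
next
  case (trans u v w) then show ?case by (blast intro: fp_eq.trans)
next
  case (multl u v x y)
  then show ?case using fp_eq.multl[of "w @ u" G K v x y] assms(2) by auto
next
  case (multr u v x y)
  then show ?case using fp_eq.multr[of "w @ u" G K v x y] assms(2) by auto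
next
  case (onel u v)
  then show ?case using fp_eq.onel[of "w @ u" G K v] assms(2) by auto
next
  case (oner u v)
  then show ?case using fp_eq.oner[of "w @ u" G K v] assms(2) by auto
qed

lemma fp_eq_append_right:
  assumes "fp_eq G K u v" "w \<in> fp_words G K"
  shows "fp_eq G K (u @ w) (v @ w)"
  using assms(1)
proof induction
  case (refl u) then show ?case using assms(2) by (intro fp_eq.refl) simp
next
  case (sym u v) then show ?case by (blast intro: fp_eq.sym)
next
  case (trans u v w) then show ?case by (blast intro: fp_eq.trans)
next
  case (multl u v x y)
  then show ?case using fp_eq.multl[of u G K "v @ w" x y] assms(2) by auto
next
  case (multr u v x y)
  then show ?case using fp_eq.multr[of u G K "v @ w" x y] assms(2) by auto
next
  case (onel u v)
  then show ?case using fp_eq.onel[of u G K "v @ w"] assms(2) by auto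
next
  case (oner u v)
  then show ?case using fp_eq.oner[of u G K "v @ w"] assms(2) by auto
qed

lemma fp_class_eq_iff:
  assumes "u \<in> fp_words G K" "v \<in> fp_words G K"
  shows "fp_class G K u = fp_class G K v \<longleftrightarrow> fp_eq G K u v"
  using assms unfolding fp_class_def by (auto intro: fp_eq.intros)

lemma fp_mult_class:
  assumes "group G" "group K" "u \<in> fp_words G K" "v \<in> fp_words G K"
  shows "fp_class G K u \<otimes>\<^bsub>free_product G K\<^esub> fp_class G K v = fp_class G K (u @ v)"
proof -
  have *: "fp_class G K (u' @ v') = fp_class G K (u @ v)"
    if "fp_eq G K u u'" "fp_eq G K v v'" for u' v'
  proof -
    have w: "u' \<in> fp_words G K" "v' \<in> fp_words G K"
      using that fp_eq_words[OF assms(1,2)] by blast+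
    have "fp_eq G K (u @ v) (u' @ v')"
      using fp_eq.trans[OF fp_eq_append_right[OF that(1) assms(4)] fp_eq_append_left[OF that(2) w(1)]] .
    then have "fp_eq G K (u' @ v') (u @ v)" by (rule fp_eq.sym)
    then show ?thesis using fp_class_eq_iff[of "u' @ v'" G K "u @ v"] w assms(3,4) by simp
  qed
  have "u \<in> fp_class G K u" "v \<in> fp_class G K v"
    using assms(3,4) by (auto simp: fp_class_def intro: fp_eq.refl)
  moreover have "fp_class G K (u' @ v') = fp_class G K (u @ v)"
    if "u' \<in> fp_class G K u" "v' \<in> fp_class G K v" for u' v'
    using * that by (simp add: fp_class_def)
  ultimately have "(\<Union>u'\<in>fp_class G K u. \<Union>v'\<in>fp_class G K v. fp_class G K (u' @ v')) =
      fp_class G K (u @ v)"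
    by blast
  then show ?thesis by (simp add: free_product_def)
qed

lemma fp_class_in_carrier [simp]:
  "w \<in> fp_words G K \<Longrightarrow> fp_class G K w \<in> carrier (free_product G K)"
  by (simp add: free_product_def)

lemma fp_one: "\<one>\<^bsub>free_product G K\<^esub> = fp_class G K []"
  by (simp add: free_product_def)

lemma fp_carrierE:
  assumes "A \<in> carrier (free_product G K)"
  obtains w where "w \<in> fp_words G K" "A = fp_class G K w"
  using assms by (auto simp: free_product_def)

lemma fp_left_inverse:
  assumes "group G" "group K" "w \<in> fp_words G K"
  shows "\<exists>v \<in> fp_words G K. fp_eq G K (v @ w) []"
  using assms(3)
proof (induction w)
  case Nil
  then show ?case using fp_eq.refl[of "[]" G K] by auto
next
  case (Cons a w)
  then have a: "a \<in> carrier G <+> carrier K" and w: "w \<in> fp_words G K" by auto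
  from Cons obtain v where v: "v \<in> fp_words G K" "fp_eq G K (v @ w) []" by auto
  obtain b where b: "b \<in> carrier G <+> carrier K" "fp_eq G K (v @ [b, a] @ w) (v @ w)"
  proof (cases a)
    case (Inl x)
    then have x: "x \<in> carrier G" using a by auto
    have "fp_eq G K (v @ [Inl (inv\<^bsub>G\<^esub> x), Inl x] @ w) (v @ [Inl \<one>\<^bsub>G\<^esub>] @ w)"
      using fp_eq.multl[OF v(1) w group.inv_closed[OF assms(1) x] x] group.l_inv[OF assms(1) x] by simp
    then have "fp_eq G K (v @ [Inl (inv\<^bsub>G\<^esub> x), a] @ w) (v @ w)"
      using fp_eq.trans fp_eq.onel[OF v(1) w] Inl by blast
    with that[OF InlI[OF group.inv_closed[OF assms(1) x]]] show thesis by simp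
  next
    case (Inr x)
    then have x: "x \<in> carrier K" using a by auto
    have "fp_eq G K (v @ [Inr (inv\<^bsub>K\<^esub> x), Inr x] @ w) (v @ [Inr \<one>\<^bsub>K\<^esub>] @ w)"
      using fp_eq.multr[OF v(1) w group.inv_closed[OF assms(2) x] x] group.l_inv[OF assms(2) x] by simp
    then have "fp_eq G K (v @ [Inr (inv\<^bsub>K\<^esub> x), a] @ w) (v @ w)"
      using fp_eq.trans fp_eq.oner[OF v(1) w] Inr by blast
    with that[OF InrI[OF group.inv_closed[OF assms(2) x]]] show thesis by simp
  qed
  have "fp_eq G K ((v @ [b]) @ a # w) []"
    using fp_eq.trans[OF b(2) v(2)] by simp
  moreover have "v @ [b] \<in> fp_words G K" using v b by auto
  ultimately show ?case by blast
qed

lemma group_free_product: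
  assumes "group G" "group K"
  shows "group (free_product G K)"
proof (rule groupI)
  fix A B assume "A \<in> carrier (free_product G K)" "B \<in> carrier (free_product G K)"
  then obtain u v where uv: "u \<in> fp_words G K" "A = fp_class G K u"
      "v \<in> fp_words G K" "B = fp_class G K v" by (metis fp_carrierE)
  then show "A \<otimes>\<^bsub>free_product G K\<^esub> B \<in> carrier (free_product G K)"
    by (simp add: fp_mult_class[OF assms])
  fix C assume "C \<in> carrier (free_product G K)"
  then obtain w where "w \<in> fp_words G K" "C = fp_class G K w" by (metis fp_carrierE)
  with uv show "A \<otimes>\<^bsub>free_product G K\<^esub> B \<otimes>\<^bsub>free_product G K\<^esub> C =
      A \<otimes>\<^bsub>free_product G K\<^esub> (B \<otimes>\<^bsub>free_product G K\<^esub> C)"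
    by (simp add: fp_mult_class[OF assms])
next
  show "\<one>\<^bsub>free_product G K\<^esub> \<in> carrier (free_product G K)" by (simp add: fp_one)
next
  fix A assume "A \<in> carrier (free_product G K)"
  then obtain u where u: "u \<in> fp_words G K" "A = fp_class G K u" by (metis fp_carrierE)
  then show "\<one>\<^bsub>free_product G K\<^esub> \<otimes>\<^bsub>free_product G K\<^esub> A = A"
    by (simp add: fp_mult_class[OF assms] fp_one)
  obtain v where v: "v \<in> fp_words G K" "fp_eq G K (v @ u) []"
    using fp_left_inverse[OF assms u(1)] by blast
  then have "fp_class G K v \<otimes>\<^bsub>free_product G K\<^esub> A = \<one>\<^bsub>free_product G K\<^esub>"
    using u fp_class_eq_iff[of "v @ u" G K "[]"] by (simp add: fp_mult_class[OF assms] fp_one)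
  with fp_class_in_carrier[OF v(1)]
  show "\<exists>B\<in>carrier (free_product G K). B \<otimes>\<^bsub>free_product G K\<^esub> A = \<one>\<^bsub>free_product G K\<^esub>"
    by blast
qed

lemma fp_inl_hom:
  assumes "group G" "group K"
  shows "fp_inl G K \<in> hom G (free_product G K)"
proof (rule homI)
  fix x assume x: "x \<in> carrier G"
  then show "fp_inl G K x \<in> carrier (free_product G K)"
    unfolding fp_inl_def by (intro fp_class_in_carrier) auto
  fix y assume y: "y \<in> carrier G"
  have "fp_eq G K [Inl (x \<otimes>\<^bsub>G\<^esub> y)] [Inl x, Inl y]"
    using fp_eq.sym[OF fp_eq.multl[of "[]" G K "[]" x y]] x y by simp
  then show "fp_inl G K (x \<otimes>\<^bsub>G\<^esub> y) = fp_inl G K x \<otimes>\<^bsub>free_product G K\<^esub> fp_inl G K y"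
    using x y assms fp_class_eq_iff[of "[Inl (x \<otimes>\<^bsub>G\<^esub> y)]" G K "[Inl x, Inl y]"]
    by (simp add: fp_inl_def fp_mult_class monoid.m_closed group.is_monoid InlI)
qed

lemma fp_inr_hom:
  assumes "group G" "group K"
  shows "fp_inr G K \<in> hom K (free_product G K)"
proof (rule homI)
  fix x assume x: "x \<in> carrier K"
  then show "fp_inr G K x \<in> carrier (free_product G K)"
    unfolding fp_inr_def by (intro fp_class_in_carrier) auto
  fix y assume y: "y \<in> carrier K"
  have "fp_eq G K [Inr (x \<otimes>\<^bsub>K\<^esub> y)] [Inr x, Inr y]"
    using fp_eq.sym[OF fp_eq.multr[of "[]" G K "[]" x y]] x y by simp
  then show "fp_inr G K (x \<otimes>\<^bsub>K\<^esub> y) = fp_inr G K x \<otimes>\<^bsub>free_product G K\<^esub> fp_inr G K y"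
    using x y assms fp_class_eq_iff[of "[Inr (x \<otimes>\<^bsub>K\<^esub> y)]" G K "[Inr x, Inr y]"]
    by (simp add: fp_inr_def fp_mult_class monoid.m_closed group.is_monoid InrI)
qed

text \<open>Universal property of the free product (existence and uniqueness).\<close>

primrec fp_eval :: "('c, 'k) monoid_scheme \<Rightarrow> ('a \<Rightarrow> 'c) \<Rightarrow> ('b \<Rightarrow> 'c) \<Rightarrow> ('a + 'b) list \<Rightarrow> 'c"
  where
    "fp_eval L f g [] = \<one>\<^bsub>L\<^esub>"
  | "fp_eval L f g (a # w) = case_sum f g a \<otimes>\<^bsub>L\<^esub> fp_eval L f g w"

context
  fixes G :: "('a, 'm) monoid_scheme" and K :: "('b, 'n) monoid_scheme"
    and L :: "('c, 'k) monoid_scheme" and f g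
  assumes G: "group G" and K: "group K" and L: "group L"
    and f: "f \<in> hom G L" and g: "g \<in> hom K L"
begin

interpretation L: group L by (rule L)

lemma fp_eval_closed: "w \<in> fp_words G K \<Longrightarrow> fp_eval L f g w \<in> carrier L"
  by (induction w) (use f g in \<open>auto simp: hom_def Pi_iff\<close>)

lemma fp_eval_append:
  "u \<in> fp_words G K \<Longrightarrow> v \<in> fp_words G K \<Longrightarrow>
    fp_eval L f g (u @ v) = fp_eval L f g u \<otimes>\<^bsub>L\<^esub> fp_eval L f g v"
proof (induction u)
  case Nil
  then show ?case by (simp add: fp_eval_closed)
next
  case (Cons a u)
  then have "case_sum f g a \<in> carrier L" using f g by (auto simp: hom_def Pi_iff)
  with Cons show ?case by (simp add: fp_eval_closed L.m_assoc)
qed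

lemma fp_eval_eq: "fp_eq G K u v \<Longrightarrow> fp_eval L f g u = fp_eval L f g v"
proof (induction rule: fp_eq.induct)
  case (multl u v x y)
  moreover have "x \<otimes>\<^bsub>G\<^esub> y \<in> carrier G" "f x \<in> carrier L" "f y \<in> carrier L"
      "f (x \<otimes>\<^bsub>G\<^esub> y) = f x \<otimes>\<^bsub>L\<^esub> f y"
    using multl f G by (auto simp: hom_def Pi_iff monoid.m_closed group.is_monoid)
  ultimately show ?case by (simp add: fp_eval_append fp_eval_closed InlI L.m_assoc)
next
  case (multr u v x y)
  moreover have "x \<otimes>\<^bsub>K\<^esub> y \<in> carrier K" "g x \<in> carrier L" "g y \<in> carrier L"
      "g (x \<otimes>\<^bsub>K\<^esub> y) = g x \<otimes>\<^bsub>L\<^esub> g y"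
    using multr g K by (auto simp: hom_def Pi_iff monoid.m_closed group.is_monoid)
  ultimately show ?case by (simp add: fp_eval_append fp_eval_closed InrI L.m_assoc)
next
  case (onel u v)
  moreover have "f \<one>\<^bsub>G\<^esub> = \<one>\<^bsub>L\<^esub>" "\<one>\<^bsub>G\<^esub> \<in> carrier G"
    using hom_one[OF f G L] G by (auto simp: group.is_monoid)
  ultimately show ?case by (simp add: fp_eval_append fp_eval_closed InlI)
next
  case (oner u v)
  moreover have "g \<one>\<^bsub>K\<^esub> = \<one>\<^bsub>L\<^esub>" "\<one>\<^bsub>K\<^esub> \<in> carrier K"
    using hom_one[OF g K L] K by (auto simp: group.is_monoid)
  ultimately show ?case by (simp add: fp_eval_append fp_eval_closed InrI)
qed auto

lemma free_product_universal:
  "\<exists>\<phi>\<in>hom (free_product G K) L.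
    (\<forall>x\<in>carrier G. \<phi> (fp_inl G K x) = f x) \<and> (\<forall>y\<in>carrier K. \<phi> (fp_inr G K y) = g y)"
proof -
  define \<phi> where "\<phi> A = fp_eval L f g (SOME w. w \<in> A)" for A
  have \<phi>: "\<phi> (fp_class G K w) = fp_eval L f g w" if "w \<in> fp_words G K" for w
  proof -
    have "w \<in> fp_class G K w" using that by (simp add: fp_class_def fp_eq.refl)
    then have "(SOME v. v \<in> fp_class G K w) \<in> fp_class G K w" by (rule someI)
    then show ?thesis unfolding \<phi>_def using fp_eval_eq by (simp add: fp_class_def)
  qed
  have "\<phi> \<in> hom (free_product G K) L"
  proof (rule homI)
    fix A B assume "A \<in> carrier (free_product G K)" "B \<in> carrier (free_product G K)"
    then obtain u v where uv: "u \<in> fp_words G K" "A = fp_class G K u"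
        "v \<in> fp_words G K" "B = fp_class G K v" by (metis fp_carrierE)
    then show "\<phi> (A \<otimes>\<^bsub>free_product G K\<^esub> B) = \<phi> A \<otimes>\<^bsub>L\<^esub> \<phi> B"
      by (simp add: fp_mult_class[OF G K] \<phi> fp_eval_append)
  qed (metis fp_carrierE \<phi> fp_eval_closed)
  moreover have "\<phi> (fp_inl G K x) = f x" if "x \<in> carrier G" for x
    using that f by (simp add: fp_inl_def \<phi> InlI hom_def Pi_iff)
  moreover have "\<phi> (fp_inr G K y) = g y" if "y \<in> carrier K" for y
    using that g by (simp add: fp_inr_def \<phi> InrI hom_def Pi_iff)
  ultimately show ?thesis by blast
qed

lemma free_product_hom_unique:
  assumes \<phi>: "\<phi> \<in> hom (free_product G K) L"
    and "\<forall>x\<in>carrier G. \<phi> (fp_inl G K x) = f x" "\<forall>y\<in>carrier K. \<phi> (fp_inr G K y) = g y"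
    and A: "w \<in> fp_words G K"
  shows "\<phi> (fp_class G K w) = fp_eval L f g w"
  using A
proof (induction w)
  case Nil
  then show ?case
    using hom_one[OF \<phi> group_free_product[OF G K] L] by (simp add: fp_one)
next
  case (Cons a w)
  then have a: "[a] \<in> fp_words G K" and w: "w \<in> fp_words G K" by auto
  have "\<phi> (fp_class G K (a # w)) = \<phi> (fp_class G K [a]) \<otimes>\<^bsub>L\<^esub> \<phi> (fp_class G K w)"
    using fp_mult_class[OF G K a w] hom_mult[OF \<phi>, of "fp_class G K [a]" "fp_class G K w"] a w
    by simp
  moreover have "\<phi> (fp_class G K [a]) = case_sum f g a"
    using a assms(2,3) by (auto simp: fp_inl_def fp_inr_def)
  ultimately show ?case using Cons w by simp
qed

end

lemma normal_closure_normal: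
  assumes "group G" "S \<subseteq> carrier G"
  shows "normal_closure G S \<lhd> G"
proof -
  interpret group G by fact
  have ne: "carrier G \<in> {N. N \<lhd> G \<and> S \<subseteq> N}"
    using assms(2) normal_inv_iff subgroup_self by auto
  show ?thesis
    unfolding normal_closure_def
  proof (rule normal_inv_iff[THEN iffD2], intro conjI)
    show "subgroup (\<Inter>{N. N \<lhd> G \<and> S \<subseteq> N}) G"
      by (rule subgroups_Inter) (use ne in \<open>auto simp: normal_imp_subgroup\<close>)
  qed (auto simp: normal_inv_iff)
qed

lemma weak_commutators_carrier:
  assumes "group H"
  shows "weak_commutators H \<subseteq> carrier (free_product H H)"
proof -
  interpret F: group "free_product H H" by (rule group_free_product[OF assms assms])
  show ?thesis
    using hom_in_carrier[OF fp_inl_hom[OF assms assms]] hom_in_carrier[OF fp_inr_hom[OF assms assms]]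
    by (auto simp: weak_commutators_def group_commutator_def)
qed

lemma group_weak_commutativity_group:
  assumes "group H"
  shows "group (\<chi> H)"
  unfolding weak_commutativity_group_def
  by (intro normal.factorgroup_is_group normal_closure_normal group_free_product
      weak_commutators_carrier assms)

end

theory Submission
  imports Defs
begin

text \<open>
  Write \<open>i, j : H \<rightarrow> \<chi>(H)\<close> for the two copies and \<open>\<delta>(h) = i(h)\<inverse> j(h)\<close>. There are three homomorphisms
  \<open>p, q, r : \<chi>(H) \<rightarrow> H\<close>: two of them kill one copy and are the identity on the other, and \<open>r\<close> is the
  identity on both. Let \<open>W\<close> be the intersection of their kernels, so that \<open>\<chi>(H)/W\<close> embeds into
  \<open>H \<times> H \<times> H\<close>. If \<open>P\<close> is a polycyclic normal subgroup of finite index in \<open>H\<close>, then the elements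
  that all three maps send into \<open>P\<close> form a normal subgroup \<open>N \<supseteq> W\<close> of finite index, and \<open>N/W\<close> is
  polycyclic. It remains to see that \<open>W\<close> is polycyclic. (For polycyclic \<open>H\<close> take \<open>P = H\<close>; then
  \<open>N = \<chi>(H)\<close>.)

  Let \<open>L\<close> be the subgroup generated by all \<open>\<delta>(h)\<close>. Three facts about \<open>L\<close> suffice.

  \<^item> \<open>L\<close> contains \<open>W\<close>, because \<open>L\<close> is normal and \<open>\<chi>(H) = i(H) L\<close>, so that \<open>L\<close> is the kernel of \<open>r\<close>
    (\<open>kernel_r_subset_L\<close>).

  \<^item> \<open>W\<close> is central in \<open>L\<close>. Expanding the relation that \<open>i(xy)\<close> and \<open>j(xy)\<close> commute shows that the
    commutator \<open>\<kappa>(x,y)\<close> of \<open>i(x)\<close> and \<open>j(y)\<inverse>\<close> does not change when \<open>i\<close> and \<open>j\<close> are exchanged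
    (\<open>\<kappa>_swap\<close>), and then the two resulting formulas for \<open>\<kappa>(xz,y)\<close> show that \<open>\<kappa>(x,y)\<close> commutes with
    \<open>\<delta>(z)\<close>. The kernel of \<open>p\<close> and \<open>q\<close> is generated by conjugates of such commutators.

  \<^item> \<open>L\<close> is finitely generated if \<open>H\<close> is. Since \<open>i(u)\<close> and \<open>j(u)\<close> commute, \<open>\<delta>(u\<inverse>) = \<delta>(u)\<inverse>\<close>, and
    hence \<open>\<delta>(u\<inverse>g) = \<delta>(g) \<delta>(ug)\<inverse> \<delta>(g)\<close>. So if a subgroup contains \<open>\<delta>(g)\<close> and \<open>\<delta>(ug)\<close>, it contains
    \<open>\<delta>(u\<inverse>g)\<close>. A rewriting argument on words (\<open>distinct_words_suffice\<close>) deduces that the values of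
    \<open>\<delta>\<close> on the words without repeated letters, which are finitely many, generate \<open>L\<close>; the letters are
    the generators of \<open>H\<close> and their inverses.

  Now \<open>M = N \<inter> L\<close> has finite index in \<open>L\<close> and is therefore finitely generated. It is an extension of
  the central subgroup \<open>W\<close> by a polycyclic group. A polycyclic analogue of Schur's theorem on the
  commutator subgroup (\<open>derived_polycyclic_of_central_by_polycyclic\<close>) says that its commutator
  subgroup \<open>M'\<close> is polycyclic, and \<open>M/M'\<close> is abelian and finitely generated. So \<open>M\<close> is
  polycyclic, and with it \<open>W\<close>.
\<close>

section \<open>Series with cyclic factors\<close>

text \<open>A polycyclic series that may start at any subgroup \<open>K\<close>, so that quotients such as \<open>N/W\<close> above need
  no quotient group. The factors are described by elements: the larger subgroup normalises \<open>A\<close>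
  and is the union of the cosets \<open>A t\<^sup>i\<close>.\<close>
inductive cyclic_series :: "('a, 'b) monoid_scheme \<Rightarrow> 'a set \<Rightarrow> 'a set \<Rightarrow> bool"
  for G K where
    base: "subgroup K G \<Longrightarrow> cyclic_series G K K"
  | step: "\<lbrakk>cyclic_series G K A; subgroup B G; A \<subseteq> B;
      \<And>b a. \<lbrakk>b \<in> B; a \<in> A\<rbrakk> \<Longrightarrow> b \<otimes>\<^bsub>G\<^esub> a \<otimes>\<^bsub>G\<^esub> inv\<^bsub>G\<^esub> b \<in> A; t \<in> B;
      \<And>b. b \<in> B \<Longrightarrow> \<exists>i::int. b \<in> A #>\<^bsub>G\<^esub> t [^]\<^bsub>G\<^esub> i\<rbrakk>
      \<Longrightarrow> cyclic_series G K B"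

lemma cyclic_series_subgroup:
  assumes "cyclic_series G K H"
  shows "subgroup K G" "subgroup H G" "K \<subseteq> H"
  using assms by induction auto

lemma cyclic_series_trans:
  assumes "cyclic_series G K H" "cyclic_series G H M"
  shows "cyclic_series G K M"
  using assms(2,1) by induction (auto intro: cyclic_series.intros)

context group
begin

lemma cancel_inv_mult:
  assumes "x \<in> carrier G" "y \<in> carrier G"
  shows "inv x \<otimes> (x \<otimes> y) = y" "x \<otimes> (inv x \<otimes> y) = y"
  using assms by (simp_all flip: m_assoc)

text \<open>Together with the rules for \<open>\<one>\<close> in the simpset, these equations decide the word problem
  of free groups.\<close>
lemmas word_simps = m_assoc inv_mult_group cancel_inv_mult

lemma r_coset_iff: "x \<in> A #> y \<longleftrightarrow> (\<exists>a\<in>A. x = a \<otimes> y)"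
  by (auto simp: r_coset_def)

text \<open>If all powers of \<open>t\<close> normalise \<open>A\<close>, then the exponent \<open>i\<close> of the coset \<open>A t\<^sup>i\<close> behaves additively
  although \<open>i\<close> need not be determined by the coset.\<close>
lemma coset_of_power:
  assumes A: "subgroup A G" and t: "t \<in> carrier G"
    and conj: "\<forall>a\<in>A. \<forall>i::int. t [^] i \<otimes> a \<otimes> inv (t [^] i) \<in> A"
  shows coset_of_power_diff:
      "\<And>x y i j. \<lbrakk>x \<in> A #> t [^] (i::int); y \<in> A #> t [^] (j::int)\<rbrakk> \<Longrightarrow> x \<otimes> inv y \<in> A #> t [^] (i - j)"
    and coset_of_power_zero: "A #> t [^] (0::int) = A"
    and coset_of_power_add:
      "\<And>x y i j. \<lbrakk>x \<in> A #> t [^] (i::int); y \<in> A #> t [^] (j::int)\<rbrakk> \<Longrightarrow> x \<otimes> y \<in> A #> t [^] (i + j)"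
    and coset_of_power_pow:
      "\<And>x i n. x \<in> A #> t [^] (i::int) \<Longrightarrow> x [^] (n::int) \<in> A #> t [^] (n * i)"
proof -
  note Ac = subgroup.mem_carrier[OF A]
  have car: "x \<in> carrier G" if "x \<in> A #> t [^] i" for x and i :: int
    using that t Ac by (auto simp: r_coset_iff)
  show zero: "A #> t [^] (0::int) = A"
    using coset_mult_one[OF subgroup.subset[OF A]] by simp
  show diff: "x \<otimes> inv y \<in> A #> t [^] (i - j)"
    if x: "x \<in> A #> t [^] i" and y: "y \<in> A #> t [^] j" for x y and i j :: int
  proof -
    obtain a b where a: "a \<in> A" "x = a \<otimes> t [^] i" and b: "b \<in> A" "y = b \<otimes> t [^] j"
      using x y by (auto simp: r_coset_iff)
    define u where "u = t [^] (i - j)"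
    have u: "u \<in> carrier G" using t by (simp add: u_def)
    have "x \<otimes> inv y = a \<otimes> (t [^] i \<otimes> inv (t [^] j)) \<otimes> inv b"
      using a b t Ac by (simp add: word_simps)
    also have "t [^] i \<otimes> inv (t [^] j) = u"
      using t by (simp add: u_def int_pow_diff)
    also have "a \<otimes> u \<otimes> inv b = (a \<otimes> (u \<otimes> inv b \<otimes> inv u)) \<otimes> u"
      using a b u Ac by (simp add: word_simps)
    finally have "x \<otimes> inv y = (a \<otimes> (u \<otimes> inv b \<otimes> inv u)) \<otimes> u" .
    moreover have "a \<otimes> (u \<otimes> inv b \<otimes> inv u) \<in> A"
      using a b conj A unfolding u_def by (simp add: subgroup.m_closed subgroup.m_inv_closed)
    ultimately show ?thesis unfolding u_def r_coset_iff by blast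
  qed
  have one: "\<one> \<in> A #> t [^] (0::int)"
    using zero subgroup.one_closed[OF A] by simp
  have neg: "inv y \<in> A #> t [^] (- j)" if "y \<in> A #> t [^] j" for y and j :: int
    using diff[OF one that] car[OF that] by simp
  show add: "x \<otimes> y \<in> A #> t [^] (i + j)"
    if "x \<in> A #> t [^] i" and "y \<in> A #> t [^] j" for x y and i j :: int
    using diff[OF that(1) neg[OF that(2)]] car[OF that(2)] by simp
  have nat: "x [^] n \<in> A #> t [^] (int n * i)" if "x \<in> A #> t [^] i" for x n and i :: int
  proof (induction n)
    case 0 then show ?case using one by simp
  next
    case (Suc n)
    have "int n * i + i = int (Suc n) * i" by (simp add: algebra_simps)
    then show ?case using add[OF Suc that] by simp
  qed
  show "x [^] n \<in> A #> t [^] (n * i)" if "x \<in> A #> t [^] i" for x and n i :: int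
  proof (cases "n < 0")
    case True
    then have "x [^] n = inv (x [^] nat (- n))" by (simp add: int_pow_def2[of G x n])
    moreover have "- (int (nat (- n)) * i) = n * i" using True by simp
    ultimately show ?thesis using neg[OF nat[OF that, of "nat (- n)"]] by (simp only:)
  next
    case False
    then have "x [^] n = x [^] nat n" by (simp only: int_pow_def2[of G x n] if_False)
    moreover have "int (nat n) * i = n * i" using False by simp
    ultimately show ?thesis using nat[OF that, of "nat n"] by (simp only:)
  qed
qed

end

lemma int_subgroup_principal:
  fixes I :: "int set"
  assumes "0 \<in> I" and diff: "\<And>i j. \<lbrakk>i \<in> I; j \<in> I\<rbrakk> \<Longrightarrow> i - j \<in> I"
  obtains d where "d \<in> I" "\<And>i. i \<in> I \<Longrightarrow> d dvd i"
proof -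
  have neg: "- i \<in> I" if "i \<in> I" for i using diff[OF assms(1) that] by simp
  have add: "i + j \<in> I" if "i \<in> I" "j \<in> I" for i j using diff[OF that(1) neg[OF that(2)]] by simp
  have nmult: "int n * i \<in> I" if "i \<in> I" for n i
    by (induction n) (use assms(1) add that in \<open>auto simp: algebra_simps\<close>)
  have mult: "n * i \<in> I" if "i \<in> I" for n i
    using nmult[OF that, of "nat n"] neg[OF nmult[OF that, of "nat (- n)"]] by (cases "n \<ge> 0") auto
  show thesis
  proof (cases "I \<subseteq> {0}")
    case True
    then show thesis using that[of 0] assms(1) by auto
  next
    case False
    then obtain i where i: "i \<in> I" "i \<noteq> 0" by auto
    then have "int (nat \<bar>i\<bar>) \<in> I \<and> nat \<bar>i\<bar> > 0" using neg[OF i(1)] by (simp add: abs_if)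
    then have ex: "\<exists>n::nat. int n \<in> I \<and> n > 0" by blast
    define n where "n = (LEAST n::nat. int n \<in> I \<and> n > 0)"
    have n: "int n \<in> I" "n > 0"
      using LeastI_ex[OF ex] unfolding n_def by auto
    have "int n dvd j" if j: "j \<in> I" for j
    proof -
      have "j - (j div int n) * int n \<in> I" using diff[OF j mult[OF n(1)]] .
      then have "j mod int n \<in> I" by (simp add: minus_div_mult_eq_mod)
      moreover have "0 \<le> j mod int n" "j mod int n < int n" using n(2) by auto
      ultimately have "int (nat (j mod int n)) \<in> I" "nat (j mod int n) < n" by auto
      then have "nat (j mod int n) = 0"
        using not_less_Least[of "nat (j mod int n)" "\<lambda>n. int n \<in> I \<and> n > 0"] unfolding n_def by auto
      with \<open>0 \<le> j mod int n\<close> show ?thesis by (simp add: dvd_eq_mod_eq_0)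
    qed
    then show thesis using that n(1) by blast
  qed
qed

text \<open>Pulling a series back along a homomorphism keeps its factors cyclic because subgroups of cyclic
  groups are cyclic. This covers subgroups (the identity map) as well as extensions: together with
  \<open>cyclic_series_trans\<close> it builds a series of a group from one of an image and one of the kernel.\<close>
lemma cyclic_series_vimage:
  assumes "cyclic_series Q P\<^sub>0 P" and G: "group G" and Q: "group Q"
    and \<phi>: "\<phi> \<in> hom G Q" and "subgroup H G" and "\<phi> ` H \<subseteq> P"
  shows "cyclic_series G {h \<in> H. \<phi> h \<in> P\<^sub>0} H"
  using assms(1,5,6)
proof (induction arbitrary: H)
  case base
  then have "{h \<in> H. \<phi> h \<in> P\<^sub>0} = H" by auto
  with base show ?case by (simp add: cyclic_series.base)
next
  case (step A B t)
  interpret G: group G by (rule G)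
  interpret Q: group Q by (rule Q)
  interpret \<phi>: group_hom G Q \<phi> using \<phi> by unfold_locales
  note A = cyclic_series_subgroup[OF step.hyps(1)]
  note Hc = subgroup.mem_carrier[OF step.prems(1)]
  have tc: "t \<in> carrier Q" using step.hyps by (meson subgroup.mem_carrier)
  have conj: "\<forall>a\<in>A. \<forall>i::int. t [^]\<^bsub>Q\<^esub> i \<otimes>\<^bsub>Q\<^esub> a \<otimes>\<^bsub>Q\<^esub> inv\<^bsub>Q\<^esub> (t [^]\<^bsub>Q\<^esub> i) \<in> A"
    using step.hyps(4) Q.subgroup_int_pow_closed[OF step.hyps(2,5)] by blast
  note cop = Q.coset_of_power_diff[OF A(2) tc conj] Q.coset_of_power_zero[OF A(2) tc conj]
    Q.coset_of_power_pow[OF A(2) tc conj]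
  define H\<^sub>1 where "H\<^sub>1 = {h \<in> H. \<phi> h \<in> A}"
  have H\<^sub>1_iff: "h \<in> H\<^sub>1 \<longleftrightarrow> h \<in> H \<and> \<phi> h \<in> A" for h by (simp add: H\<^sub>1_def)
  have H\<^sub>1: "subgroup H\<^sub>1 G"
  proof (rule G.subgroupI)
    show "H\<^sub>1 \<subseteq> carrier G" using Hc by (auto simp: H\<^sub>1_iff)
    have "\<one>\<^bsub>G\<^esub> \<in> H\<^sub>1"
      using subgroup.one_closed[OF step.prems(1)] subgroup.one_closed[OF A(2)] by (simp add: H\<^sub>1_iff)
    then show "H\<^sub>1 \<noteq> {}" by blast
    show "inv\<^bsub>G\<^esub> a \<in> H\<^sub>1" if "a \<in> H\<^sub>1" for a
      using that Hc[of a] subgroup.m_inv_closed[OF step.prems(1), of a] subgroup.m_inv_closed[OF A(2), of "\<phi> a"]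
      by (simp add: H\<^sub>1_iff)
    show "a \<otimes>\<^bsub>G\<^esub> b \<in> H\<^sub>1" if "a \<in> H\<^sub>1" "b \<in> H\<^sub>1" for a b
      using that Hc[of a] Hc[of b] subgroup.m_closed[OF step.prems(1), of a b]
        subgroup.m_closed[OF A(2), of "\<phi> a" "\<phi> b"]
      by (simp add: H\<^sub>1_iff)
  qed
  have "cyclic_series G {h \<in> H\<^sub>1. \<phi> h \<in> P\<^sub>0} H\<^sub>1"
    by (rule step.IH[OF H\<^sub>1]) (auto simp: H\<^sub>1_def)
  moreover have "{h \<in> H\<^sub>1. \<phi> h \<in> P\<^sub>0} = {h \<in> H. \<phi> h \<in> P\<^sub>0}"
    using A(3) by (auto simp: H\<^sub>1_def)
  ultimately have ser: "cyclic_series G {h \<in> H. \<phi> h \<in> P\<^sub>0} H\<^sub>1" by simp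
  \<comment> \<open>The exponents of \<open>t\<close> that occur in the image of \<open>H\<close> form a subgroup of the integers;
    an element of \<open>H\<close> over its generator generates \<open>H\<close> modulo \<open>H\<^sub>1\<close>.\<close>
  define I where "I = {i::int. \<exists>h\<in>H. \<phi> h \<in> A #>\<^bsub>Q\<^esub> t [^]\<^bsub>Q\<^esub> i}"
  have "\<phi> \<one>\<^bsub>G\<^esub> \<in> A #>\<^bsub>Q\<^esub> t [^]\<^bsub>Q\<^esub> (0::int)"
    using subgroup.one_closed[OF A(2)] cop(2) by simp
  then have "0 \<in> I"
    using subgroup.one_closed[OF step.prems(1)] unfolding I_def by blast
  moreover have "i - j \<in> I" if "i \<in> I" "j \<in> I" for i j
  proof -
    obtain h k where hk: "h \<in> H" "k \<in> H" "\<phi> h \<in> A #>\<^bsub>Q\<^esub> t [^]\<^bsub>Q\<^esub> i" "\<phi> k \<in> A #>\<^bsub>Q\<^esub> t [^]\<^bsub>Q\<^esub> j"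
      using \<open>i \<in> I\<close> \<open>j \<in> I\<close> unfolding I_def by blast
    then have "\<phi> (h \<otimes>\<^bsub>G\<^esub> inv\<^bsub>G\<^esub> k) \<in> A #>\<^bsub>Q\<^esub> t [^]\<^bsub>Q\<^esub> (i - j)"
      using cop(1)[OF hk(3,4)] Hc by simp
    moreover have "h \<otimes>\<^bsub>G\<^esub> inv\<^bsub>G\<^esub> k \<in> H"
      using hk step.prems(1) by (simp add: subgroup.m_closed subgroup.m_inv_closed)
    ultimately show ?thesis unfolding I_def by blast
  qed
  ultimately obtain d where d: "d \<in> I" "\<And>i. i \<in> I \<Longrightarrow> d dvd i"
    using int_subgroup_principal by metis
  then obtain s where s: "s \<in> H" "\<phi> s \<in> A #>\<^bsub>Q\<^esub> t [^]\<^bsub>Q\<^esub> d" unfolding I_def by auto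
  show ?case
  proof (rule cyclic_series.step[OF ser step.prems(1) _ _ s(1)])
    show "H\<^sub>1 \<subseteq> H" by (auto simp: H\<^sub>1_def)
    show "b \<otimes>\<^bsub>G\<^esub> a \<otimes>\<^bsub>G\<^esub> inv\<^bsub>G\<^esub> b \<in> H\<^sub>1" if "b \<in> H" "a \<in> H\<^sub>1" for b a
    proof -
      have "\<phi> b \<in> B" using that(1) step.prems(2) by blast
      then show ?thesis
        using that step.hyps(4)[of "\<phi> b" "\<phi> a"] Hc[of a] Hc[of b] step.prems(1)
        by (simp add: H\<^sub>1_iff subgroup.m_closed subgroup.m_inv_closed)
    qed
    fix h assume h: "h \<in> H"
    then obtain i where i: "\<phi> h \<in> A #>\<^bsub>Q\<^esub> t [^]\<^bsub>Q\<^esub> (i::int)" using step.hyps(6) step.prems(2) by blast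
    with h have "i \<in> I" unfolding I_def by blast
    then obtain q where "i = d * q" using d(2) by (meson dvdE)
    then have q: "i = q * d" by simp
    have sq: "s [^]\<^bsub>G\<^esub> q \<in> H" by (rule G.subgroup_int_pow_closed[OF step.prems(1) s(1)])
    have "\<phi> (h \<otimes>\<^bsub>G\<^esub> inv\<^bsub>G\<^esub> (s [^]\<^bsub>G\<^esub> q)) \<in> A"
      using cop(1)[OF i cop(3)[OF s(2), of q]] cop(2) h s Hc q by (simp add: \<phi>.hom_int_pow)
    then have "h \<otimes>\<^bsub>G\<^esub> inv\<^bsub>G\<^esub> (s [^]\<^bsub>G\<^esub> q) \<in> H\<^sub>1"
      using h sq step.prems(1) by (simp add: H\<^sub>1_def subgroup.m_closed subgroup.m_inv_closed)
    moreover have "h = h \<otimes>\<^bsub>G\<^esub> inv\<^bsub>G\<^esub> (s [^]\<^bsub>G\<^esub> q) \<otimes>\<^bsub>G\<^esub> s [^]\<^bsub>G\<^esub> q"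
      using h sq Hc by (simp add: G.word_simps)
    ultimately show "\<exists>i::int. h \<in> H\<^sub>1 #>\<^bsub>G\<^esub> s [^]\<^bsub>G\<^esub> i" by (auto simp: G.r_coset_iff)
  qed
qed

lemma cyclic_series_image:
  assumes "cyclic_series Q P\<^sub>0 P" and "group G" "group Q" "\<phi> \<in> hom Q G"
  shows "cyclic_series G (\<phi> ` P\<^sub>0) (\<phi> ` P)"
proof -
  interpret G: group G by fact
  interpret Q: group Q by fact
  interpret \<phi>: group_hom Q G \<phi> using assms(4) by unfold_locales
  show ?thesis
    using assms(1)
  proof induction
    case base
    then show ?case by (intro cyclic_series.base \<phi>.subgroup_img_is_subgroup)
  next
    case (step A B t)
    note Bc = subgroup.mem_carrier[OF step.hyps(2)]
    show ?case
    proof (rule cyclic_series.step[OF step.IH])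
      show "subgroup (\<phi> ` B) G" using step.hyps by (intro \<phi>.subgroup_img_is_subgroup)
      show "\<phi> ` A \<subseteq> \<phi> ` B" "\<phi> t \<in> \<phi> ` B" using step.hyps by auto
      show "b \<otimes>\<^bsub>G\<^esub> a \<otimes>\<^bsub>G\<^esub> inv\<^bsub>G\<^esub> b \<in> \<phi> ` A" if "b \<in> \<phi> ` B" "a \<in> \<phi> ` A" for b a
      proof -
        from that obtain b' a' where b': "b' \<in> B" "a' \<in> A" "b = \<phi> b'" "a = \<phi> a'" by blast
        then have "b \<otimes>\<^bsub>G\<^esub> a \<otimes>\<^bsub>G\<^esub> inv\<^bsub>G\<^esub> b = \<phi> (b' \<otimes>\<^bsub>Q\<^esub> a' \<otimes>\<^bsub>Q\<^esub> inv\<^bsub>Q\<^esub> b')"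
          using Bc[OF b'(1)] Bc[OF subsetD[OF step.hyps(3) b'(2)]] by simp
        then show ?thesis using step.hyps(4) b' by blast
      qed
      show "\<exists>i::int. b \<in> \<phi> ` A #>\<^bsub>G\<^esub> \<phi> t [^]\<^bsub>G\<^esub> i" if "b \<in> \<phi> ` B" for b
      proof -
        from that obtain b' where b': "b' \<in> B" "b = \<phi> b'" by blast
        obtain i :: int and a where a: "a \<in> A" "b' = a \<otimes>\<^bsub>Q\<^esub> t [^]\<^bsub>Q\<^esub> i"
          using step.hyps(6)[OF b'(1)] by (auto simp: Q.r_coset_iff)
        have "b = \<phi> a \<otimes>\<^bsub>G\<^esub> \<phi> t [^]\<^bsub>G\<^esub> i"
          using a(2) b'(2) Bc[OF subsetD[OF step.hyps(3) a(1)]] Bc[OF step.hyps(5)]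
          by (simp add: \<phi>.hom_int_pow)
        then show ?thesis using a(1) by (auto simp: G.r_coset_iff)
      qed
    qed
  qed
qed

lemma (in group) cyclic_series_mono:
  assumes "cyclic_series G K H" "subgroup M G" "M \<subseteq> H"
  shows "cyclic_series G (K \<inter> M) M"
proof -
  have "cyclic_series G {m \<in> M. id m \<in> K} M"
    by (rule cyclic_series_vimage[OF assms(1) is_group is_group _ assms(2)])
      (use assms(3) in \<open>auto simp: hom_def\<close>)
  moreover have "{m \<in> M. id m \<in> K} = K \<inter> M" by auto
  ultimately show ?thesis by simp
qed

text \<open>The bridge between the definition by quotient groups and the description by elements.\<close>
lemma (in group) polycyclic_seq_iff_cyclic_series:
  "polycyclic_seq G H \<longleftrightarrow> cyclic_series G {\<one>} H"
proof
  assume "polycyclic_seq G H"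
  then show "cyclic_series G {\<one>} H"
  proof induction
    case unity
    show ?case by (rule cyclic_series.base) (simp add: triv_subgroup)
  next
    case (extension K H)
    interpret N: normal K "G\<lparr>carrier := H\<rparr>" by fact
    have inv: "inv\<^bsub>G\<lparr>carrier := H\<rparr>\<^esub> h = inv h" if "h \<in> H" for h
      using m_inv_consistent[OF extension.hyps(3) that] .
    have pow: "x [^]\<^bsub>G\<lparr>carrier := H\<rparr>\<^esub> i = x [^] i" if "x \<in> H" for x and i :: int
      using int_pow_consistent[OF extension.hyps(3) that] by simp
    have rc: "K #>\<^bsub>G\<lparr>carrier := H\<rparr>\<^esub> x = K #> x" for x by (simp add: r_coset_def)
    obtain Q\<^sub>0 where mem: "Q\<^sub>0 \<in> carrier (G\<lparr>carrier := H\<rparr> Mod K)"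
      and Q\<^sub>0: "carrier (G\<lparr>carrier := H\<rparr> Mod K) = range (\<lambda>n::int. Q\<^sub>0 [^]\<^bsub>G\<lparr>carrier := H\<rparr> Mod K\<^esub> n)"
      using extension.hyps(4) unfolding group.cyclic_group[OF N.factorgroup_is_group] by (rule bexE)
    from mem obtain t where t: "t \<in> H" "Q\<^sub>0 = K #>\<^bsub>G\<lparr>carrier := H\<rparr>\<^esub> t"
      by (auto simp: carrier_FactGroup)
    show ?case
    proof (rule cyclic_series.step[OF extension.IH extension.hyps(3) _ _ t(1)])
      show "K \<subseteq> H" using N.subset by simp
      show "b \<otimes> a \<otimes> inv b \<in> K" if "b \<in> H" "a \<in> K" for b a
        using N.inv_op_closed2[of b a] that inv[of b] by simp
      fix b assume b: "b \<in> H"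
      have "K #>\<^bsub>G\<lparr>carrier := H\<rparr>\<^esub> b \<in> range (\<lambda>n::int. Q\<^sub>0 [^]\<^bsub>G\<lparr>carrier := H\<rparr> Mod K\<^esub> n)"
        using b Q\<^sub>0 by (auto simp: carrier_FactGroup)
      then obtain i :: int where "K #>\<^bsub>G\<lparr>carrier := H\<rparr>\<^esub> b = Q\<^sub>0 [^]\<^bsub>G\<lparr>carrier := H\<rparr> Mod K\<^esub> i" by blast
      then have "K #> b = K #> t [^] i"
        using t pow[OF t(1)] N.FactGroup_int_pow[of t i] by (simp add: rc)
      moreover have "b \<in> K #> b"
        using group.rcos_self[OF N.is_group _ N.subgroup_axioms, of b] b rc by simp
      ultimately show "\<exists>i::int. b \<in> K #> t [^] i" by blast
    qed
  qed
next
  assume "cyclic_series G {\<one>} H"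
  then show "polycyclic_seq G H"
  proof induction
    case base
    show ?case by (rule polycyclic_seq.unity)
  next
    case (step A B t)
    interpret B: group "G\<lparr>carrier := B\<rparr>" using subgroup_imp_group[OF step.hyps(2)] .
    have inv: "inv\<^bsub>G\<lparr>carrier := B\<rparr>\<^esub> h = inv h" if "h \<in> B" for h
      using m_inv_consistent[OF step.hyps(2) that] .
    have pow: "x [^]\<^bsub>G\<lparr>carrier := B\<rparr>\<^esub> i = x [^] i" if "x \<in> B" for x and i :: int
      using int_pow_consistent[OF step.hyps(2) that] by simp
    have rc: "A #>\<^bsub>G\<lparr>carrier := B\<rparr>\<^esub> x = A #> x" for x by (simp add: r_coset_def)
    have A: "subgroup A G" using cyclic_series_subgroup[OF step.hyps(1)] by blast
    have AB: "subgroup A (G\<lparr>carrier := B\<rparr>)" by (rule subgroup_incl[OF A step.hyps(2,3)])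
    have N: "A \<lhd> G\<lparr>carrier := B\<rparr>"
      by (rule B.normal_invI[OF AB]) (use step.hyps(4) inv in simp)
    interpret N: normal A "G\<lparr>carrier := B\<rparr>" by (rule N)
    let ?Q\<^sub>0 = "A #>\<^bsub>G\<lparr>carrier := B\<rparr>\<^esub> t"
    have Ypow: "?Q\<^sub>0 [^]\<^bsub>G\<lparr>carrier := B\<rparr> Mod A\<^esub> i = A #> t [^] i" for i :: int
      using N.FactGroup_int_pow[of t i] step.hyps(5) pow rc by simp
    interpret F: group "G\<lparr>carrier := B\<rparr> Mod A" by (rule N.factorgroup_is_group)
    have Q\<^sub>0: "?Q\<^sub>0 \<in> carrier (G\<lparr>carrier := B\<rparr> Mod A)" using step.hyps(5) by (auto simp: carrier_FactGroup)
    have "carrier (G\<lparr>carrier := B\<rparr> Mod A) = range (\<lambda>n::int. ?Q\<^sub>0 [^]\<^bsub>G\<lparr>carrier := B\<rparr> Mod A\<^esub> n)"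
    proof (intro equalityI subsetI)
      fix Y assume "Y \<in> carrier (G\<lparr>carrier := B\<rparr> Mod A)"
      then obtain b where b: "b \<in> B" "Y = A #> b" by (auto simp: carrier_FactGroup rc)
      obtain i :: int where i: "b \<in> A #> t [^] i" using step.hyps(6)[OF b(1)] by blast
      have "A #> t [^] i = A #> b"
        by (rule repr_independence[OF i _ A])
          (use step.hyps(2,5) in \<open>auto intro: subgroup.mem_carrier\<close>)
      then have "Y = ?Q\<^sub>0 [^]\<^bsub>G\<lparr>carrier := B\<rparr> Mod A\<^esub> i" using b by (simp only: Ypow)
      then show "Y \<in> range (\<lambda>n::int. ?Q\<^sub>0 [^]\<^bsub>G\<lparr>carrier := B\<rparr> Mod A\<^esub> n)" by (rule range_eqI)
    next
      fix Y assume "Y \<in> range (\<lambda>n::int. ?Q\<^sub>0 [^]\<^bsub>G\<lparr>carrier := B\<rparr> Mod A\<^esub> n)"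
      then show "Y \<in> carrier (G\<lparr>carrier := B\<rparr> Mod A)" using Q\<^sub>0 F.int_pow_closed by blast
    qed
    then have "cyclic_group (G\<lparr>carrier := B\<rparr> Mod A)"
      using Q\<^sub>0 F.cyclic_group by blast
    then show ?case by (rule polycyclic_seq.extension[OF step.IH N step.hyps(2)])
  qed
qed

lemma (in group) polycyclic_subgroup_iff:
  assumes "subgroup N G"
  shows "polycyclic (G\<lparr>carrier := N\<rparr>) \<longleftrightarrow> cyclic_series G {\<one>} N"
proof -
  interpret N: group "G\<lparr>carrier := N\<rparr>" using subgroup_imp_group[OF assms] .
  have "cyclic_series (G\<lparr>carrier := N\<rparr>) {\<one>} N \<longleftrightarrow> cyclic_series G {\<one>} N"
  proof
    assume "cyclic_series (G\<lparr>carrier := N\<rparr>) {\<one>} N"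
    then have "cyclic_series G (id ` {\<one>}) (id ` N)"
      by (rule cyclic_series_image[OF _ is_group N.is_group])
        (use subgroup.subset[OF assms] in \<open>auto simp: hom_def\<close>)
    then show "cyclic_series G {\<one>} N" by simp
  next
    assume "cyclic_series G {\<one>} N"
    then have "cyclic_series (G\<lparr>carrier := N\<rparr>) {h \<in> N. id h \<in> {\<one>}} N"
      by (rule cyclic_series_vimage[OF _ N.is_group is_group])
        (use subgroup.subset[OF assms] N.subgroup_self in \<open>auto simp: hom_def\<close>)
    moreover have "{h \<in> N. id h \<in> {\<one>}} = {\<one>}" using subgroup.one_closed[OF assms] by auto
    ultimately show "cyclic_series (G\<lparr>carrier := N\<rparr>) {\<one>} N" by simp
  qed
  then show ?thesis
    using N.polycyclic_seq_iff_cyclic_series[of N] N.is_group by (simp add: polycyclic_def)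
qed

lemma (in group) generate_self: "subgroup K G \<Longrightarrow> generate G K = K"
  using generateI[of K K] by auto

lemma (in group) commutator_in_derived:
  assumes "a \<in> B" "b \<in> B"
  shows "a \<otimes> b \<otimes> inv a \<otimes> inv b \<in> derived G B"
  unfolding derived_def by (rule generate.incl) (use assms in blast)

lemma (in group) cyclic_series_adjoin:
  assumes "cyclic_series G K A" and s: "s \<in> carrier G"
    and conj: "\<And>b a. \<lbrakk>b \<in> generate G (insert s A); a \<in> A\<rbrakk> \<Longrightarrow> b \<otimes> a \<otimes> inv b \<in> A"
  shows "cyclic_series G K (generate G (insert s A))"
proof -
  let ?B = "generate G (insert s A)"
  have A: "subgroup A G" using cyclic_series_subgroup[OF assms(1)] by blast
  note Ac = subgroup.mem_carrier[OF A]
  have B: "subgroup ?B G" using s Ac by (intro generate_is_subgroup) auto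
  have sB: "s \<in> ?B" by (rule generate.incl) simp
  have conj': "\<forall>a\<in>A. \<forall>i::int. s [^] i \<otimes> a \<otimes> inv (s [^] i) \<in> A"
    using conj subgroup_int_pow_closed[OF B sB] by blast
  note cop = coset_of_power_diff[OF A s conj'] coset_of_power_zero[OF A s conj']
    coset_of_power_add[OF A s conj']
  show ?thesis
  proof (rule cyclic_series.step[OF assms(1) B _ conj sB])
    show "A \<subseteq> ?B" using generate.incl[of _ "insert s A" G] by blast
    have one: "\<one> \<in> A #> s [^] (0::int)"
      using cop(2) subgroup.one_closed[OF A] by simp
    have gen: "\<exists>i::int. h \<in> A #> s [^] i" if "h \<in> insert s A" for h
    proof (cases "h = s")
      case True
      then have "h = \<one> \<otimes> s [^] (1::int)" using s by simp
      then show ?thesis using subgroup.one_closed[OF A] r_coset_iff by blast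
    next
      case False
      with that cop(2) show ?thesis by blast
    qed
    fix b assume "b \<in> ?B"
    then show "\<exists>i::int. b \<in> A #> s [^] i"
    proof induction
      case one
      with \<open>\<one> \<in> A #> s [^] (0::int)\<close> show ?case by blast
    next
      case (incl h)
      then show ?case by (rule gen)
    next
      case (inv h)
      then obtain i :: int where "h \<in> A #> s [^] i" using gen by blast
      from cop(1)[OF \<open>\<one> \<in> A #> s [^] (0::int)\<close> this] show ?case
        using inv s Ac by auto
    next
      case (eng h1 h2)
      then show ?case using cop(3) by blast
    qed
  qed
qed

text \<open>A finitely generated abelian group is polycyclic; here it is the quotient by \<open>K\<close>, and the
  generators are adjoined to \<open>K\<close> one at a time.\<close>
lemma (in group) cyclic_series_abelian_extension:
  assumes "finite S" "S \<subseteq> carrier G" and K: "subgroup K G"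
    and "derived G (generate G (K \<union> S)) \<subseteq> K"
  shows "cyclic_series G K (generate G (K \<union> S))"
  using assms(1,2,4)
proof induction
  case empty
  show ?case using generate_self[OF K] cyclic_series.base[OF K] by simp
next
  case (insert s S)
  let ?A = "generate G (K \<union> S)" and ?B = "generate G (K \<union> insert s S)"
  have KS: "K \<union> insert s S \<subseteq> carrier G" using insert.prems(1) subgroup.subset[OF K] by auto
  have A: "subgroup ?A G" using KS by (intro generate_is_subgroup) auto
  have B: "subgroup ?B G" using KS by (rule generate_is_subgroup)
  have AB: "?A \<subseteq> ?B" by (rule mono_generate) auto
  have KA: "K \<subseteq> ?A" using generate.incl[of _ "K \<union> S" G] by auto
  have sB: "s \<in> ?B" by (rule generate.incl) simp
  have ser: "cyclic_series G K ?A"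
    using insert.IH insert.prems mono_derived[OF AB] by auto
  have eq: "generate G (insert s ?A) = ?B"
  proof
    show "generate G (insert s ?A) \<subseteq> ?B" using AB sB by (intro generate_subgroup_incl[OF _ B]) auto
    show "?B \<subseteq> generate G (insert s ?A)"
      using generate.incl[of _ "K \<union> S" G] by (intro mono_generate) auto
  qed
  have "cyclic_series G K (generate G (insert s ?A))"
  proof (rule cyclic_series_adjoin[OF ser])
    show "s \<in> carrier G" using KS by auto
    fix b a assume ba: "b \<in> generate G (insert s ?A)" "a \<in> ?A"
    then have "b \<in> ?B" "a \<in> ?B" using eq AB by auto
    then have "b \<otimes> a \<otimes> inv b \<otimes> inv a \<in> ?A"
      using commutator_in_derived insert.prems(2) KA by blast
    from subgroup.m_closed[OF A this ba(2)]
    show "b \<otimes> a \<otimes> inv b \<in> ?A"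
      using subgroup.mem_carrier[OF B \<open>b \<in> ?B\<close>] subgroup.mem_carrier[OF A ba(2)]
      by (simp add: word_simps)
  qed
  then show ?case by (simp only: eq)
qed

lemma (in group) cyclic_series_imp_finitely_generated:
  assumes "cyclic_series G K H"
  shows "\<exists>S. finite S \<and> S \<subseteq> H \<and> generate G (K \<union> S) = H"
  using assms
proof induction
  case base
  then show ?case using generate_self by (intro exI[of _ "{}"]) auto
next
  case (step A B t)
  then obtain S where S: "finite S" "S \<subseteq> A" "generate G (K \<union> S) = A" by blast
  have KA: "K \<subseteq> A" using cyclic_series_subgroup[OF step.hyps(1)] by blast
  have KS: "K \<union> insert t S \<subseteq> B" using KA S(2) step.hyps(3,5) by blast
  let ?C = "generate G (K \<union> insert t S)"
  have C: "subgroup ?C G"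
    using KS subgroup.subset[OF step.hyps(2)] by (intro generate_is_subgroup) blast
  have "B \<subseteq> ?C"
  proof
    fix b assume "b \<in> B"
    then obtain i :: int and a where a: "a \<in> A" "b = a \<otimes> t [^] i"
      using step.hyps(6) unfolding r_coset_iff by blast
    have "a \<in> ?C" using a(1) S(3) mono_generate[of "K \<union> S" "K \<union> insert t S"] by blast
    moreover have "t [^] i \<in> ?C" by (rule subgroup_int_pow_closed[OF C]) (simp add: generate.incl)
    ultimately show "b \<in> ?C" using a(2) generate.eng by simp
  qed
  moreover have "?C \<subseteq> B" by (rule generate_subgroup_incl[OF KS step.hyps(2)])
  ultimately show ?case
    using S(1) KS by (intro exI[of _ "insert t S"]) auto
qed

section \<open>Commutators in central extensions of polycyclic groups\<close>

text \<open>A group is abelian as soon as its generators commute; here it is the quotient of the generated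
  subgroup by \<open>T\<close>.\<close>
lemma (in group) derived_generate_subset:
  assumes T: "subgroup T G" and S: "S \<subseteq> carrier G"
    and conj: "\<And>x y. \<lbrakk>x \<in> S; y \<in> T\<rbrakk> \<Longrightarrow> x \<otimes> y \<otimes> inv x \<in> T"
      "\<And>x y. \<lbrakk>x \<in> S; y \<in> T\<rbrakk> \<Longrightarrow> inv x \<otimes> y \<otimes> x \<in> T"
    and comm: "\<And>x y. \<lbrakk>x \<in> S; y \<in> S\<rbrakk> \<Longrightarrow> x \<otimes> y \<otimes> inv x \<otimes> inv y \<in> T"
  shows "derived G (generate G S) \<subseteq> T"
proof -
  let ?M = "generate G S"
  note Tc = subgroup.mem_carrier[OF T]
  have Mc: "m \<in> carrier G" if "m \<in> ?M" for m using that generate_in_carrier[OF S] by blast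
  have Sc: "x \<in> carrier G" if "x \<in> S" for x using that S by blast
  have conjM: "m \<otimes> y \<otimes> inv m \<in> T" if "m \<in> ?M" "y \<in> T" for m y
    using that
  proof (induction arbitrary: y)
    case one then show ?case using Tc by simp
  next
    case (incl h) then show ?case by (intro conj)
  next
    case (inv h) then show ?case using conj(2)[of h y] Sc by simp
  next
    case (eng h1 h2)
    from eng.IH(1)[OF eng.IH(2)[OF eng.prems]] show ?case
      using Mc[OF eng.hyps(1)] Mc[OF eng.hyps(2)] Tc[OF eng.prems] by (simp add: word_simps)
  qed
  have sym: "b \<otimes> a \<otimes> inv b \<otimes> inv a \<in> T"
    if "a \<otimes> b \<otimes> inv a \<otimes> inv b \<in> T" "a \<in> carrier G" "b \<in> carrier G" for a b
    using subgroup.m_inv_closed[OF T that(1)] that by (simp add: word_simps)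
  have step: "m \<otimes> a \<otimes> inv m \<otimes> inv a \<in> T"
    if "m \<in> ?M" and a: "a \<in> carrier G" "\<And>x. x \<in> S \<Longrightarrow> x \<otimes> a \<otimes> inv x \<otimes> inv a \<in> T" for m a
    using that(1)
  proof induction
    case one then show ?case using a T by (simp add: subgroup.one_closed)
  next
    case (incl h) then show ?case by (rule a)
  next
    case (inv h)
    from conj(2)[OF inv sym[OF sym[OF sym[OF a(2)[OF inv]]]]]
    show ?case using Sc[OF inv] a(1) by (simp add: word_simps)
  next
    case (eng h1 h2)
    from subgroup.m_closed[OF T conjM[OF eng.hyps(1) eng.IH(2)] eng.IH(1)]
    show ?case using Mc[OF eng.hyps(1)] Mc[OF eng.hyps(2)] a(1) by (simp add: word_simps)
  qed
  have "m \<otimes> n \<otimes> inv m \<otimes> inv n \<in> T" if "m \<in> ?M" "n \<in> ?M" for m n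
  proof (rule step[OF that(1) Mc[OF that(2)]])
    fix x assume "x \<in> S"
    then show "x \<otimes> n \<otimes> inv x \<otimes> inv n \<in> T"
      by (intro sym[OF step[OF that(2)]]) (use comm Sc Mc that in auto)
  qed
  then have "derived_set G ?M \<subseteq> T" by blast
  then show ?thesis unfolding derived_def by (rule generate_subgroup_incl[OF _ T])
qed

text \<open>Induction on the series from \<open>W\<close> to \<open>M\<close>. If \<open>B\<close> is generated by \<open>A\<close> and \<open>t\<close>, then
  \<open>B'/A'\<close> is the image of \<open>A/A'\<close> under the homomorphism \<open>a \<mapsto> [a, t]\<close>. This homomorphism kills the central
  subgroup \<open>W\<close>, and \<open>A\<close> is generated by \<open>W\<close> and finitely many elements. So \<open>B'/A'\<close> is a
  finitely generated abelian group, while \<open>A'\<close> is polycyclic by induction.\<close>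
theorem (in group) derived_polycyclic_of_central_by_polycyclic:
  assumes "cyclic_series G W M" and central: "\<And>w m. \<lbrakk>w \<in> W; m \<in> M\<rbrakk> \<Longrightarrow> w \<otimes> m = m \<otimes> w"
  shows "cyclic_series G {\<one>} (derived G M)"
  using assms
proof induction
  case base
  note Wc = subgroup.mem_carrier[OF base(1)]
  have "a \<otimes> b \<otimes> inv a \<otimes> inv b = \<one>" if "a \<in> W" "b \<in> W" for a b
    using base(2)[OF that] Wc[OF that(1)] Wc[OF that(2)] by (simp add: word_simps)
  then have "derived_set G W \<subseteq> {\<one>}" by blast
  then have "derived G W \<subseteq> {\<one>}"
    unfolding derived_def by (rule generate_subgroup_incl) (rule triv_subgroup)
  moreover have "\<one> \<in> derived G W" unfolding derived_def by (rule generate.one)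
  ultimately have "derived G W = {\<one>}" by blast
  then show ?case using cyclic_series.base[OF triv_subgroup] by simp
next
  case (step A B t)
  note A = cyclic_series_subgroup[OF step.hyps(1)]
  note Ac = subgroup.mem_carrier[OF A(2)]
  note Bc = subgroup.mem_carrier[OF step.hyps(2)]
  have t: "t \<in> carrier G" using Bc step.hyps(5) by blast
  have IH: "cyclic_series G {\<one>} (derived G A)" using step.IH step.prems step.hyps(3) by blast
  have dA: "subgroup (derived G A) G" using Ac by (intro derived_is_subgroup) blast
  obtain S where S: "finite S" "S \<subseteq> A" "generate G (W \<union> S) = A"
    using cyclic_series_imp_finitely_generated[OF step.hyps(1)] by blast
  define c where "c a = a \<otimes> t \<otimes> inv a \<otimes> inv t" for a
  have cA: "c a \<in> A" if "a \<in> A" for a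
  proof -
    have "a \<otimes> (t \<otimes> inv a \<otimes> inv t) \<in> A"
      using step.hyps(4)[OF step.hyps(5)] that A(2) by (simp add: subgroup.m_closed subgroup.m_inv_closed)
    then show ?thesis using that Ac t by (simp add: c_def m_assoc)
  qed
  define T where "T = generate G (derived G A \<union> c ` S)"
  have dAA: "derived G A \<subseteq> A" by (rule derived_incl[OF _ A(2)]) simp
  have gensA: "derived G A \<union> c ` S \<subseteq> A" using cA S(2) dAA by blast
  have gensc: "derived G A \<union> c ` S \<subseteq> carrier G" using gensA Ac by blast
  have T: "subgroup T G" unfolding T_def by (rule generate_is_subgroup[OF gensc])
  have TA: "T \<subseteq> A" unfolding T_def by (rule generate_subgroup_incl[OF gensA A(2)])
  have dAT: "derived G A \<subseteq> T" unfolding T_def using generate.incl[of _ "derived G A \<union> c ` S" G] by blast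
  have "cyclic_series G (derived G A) T"
    unfolding T_def
  proof (rule cyclic_series_abelian_extension[OF _ _ dA])
    show "finite (c ` S)" using S(1) by simp
    show "c ` S \<subseteq> carrier G" using gensc by blast
    show "derived G (generate G (derived G A \<union> c ` S)) \<subseteq> derived G A"
      using mono_derived[OF TA] unfolding T_def .
  qed
  then have serT: "cyclic_series G {\<one>} T" using IH cyclic_series_trans by blast
  have conjA: "a \<otimes> y \<otimes> inv a \<in> T" if "a \<in> A" "y \<in> T" for a y
  proof -
    have "a \<otimes> y \<otimes> inv a \<otimes> inv y \<in> T"
      using commutator_in_derived[of a A y] that TA dAT by blast
    from subgroup.m_closed[OF T this that(2)] show ?thesis
      using Ac[OF that(1)] subgroup.mem_carrier[OF T that(2)] by (simp add: word_simps)
  qed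
  \<comment> \<open>Modulo \<open>T\<close> the map \<open>c\<close> is a homomorphism on \<open>A\<close>; it is trivial on \<open>W\<close> and on \<open>S\<close>.\<close>
  define C where "C = {a \<in> A. c a \<in> T}"
  have C: "subgroup C G"
  proof (rule subgroupI)
    show "C \<subseteq> carrier G" using Ac by (auto simp: C_def)
    have "\<one> \<in> C" using subgroup.one_closed[OF A(2)] subgroup.one_closed[OF T] t by (simp add: C_def c_def)
    then show "C \<noteq> {}" by blast
    show "inv a \<in> C" if "a \<in> C" for a
    proof -
      have a: "a \<in> A" "c a \<in> T" using that by (auto simp: C_def)
      have ia: "inv a \<in> A" using subgroup.m_inv_closed[OF A(2) a(1)] .
      from conjA[OF ia subgroup.m_inv_closed[OF T a(2)]]
      have "c (inv a) \<in> T" using Ac[OF a(1)] t by (simp add: c_def word_simps)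
      with ia show ?thesis by (simp add: C_def)
    qed
    show "a \<otimes> b \<in> C" if "a \<in> C" "b \<in> C" for a b
    proof -
      have ab: "a \<in> A" "c a \<in> T" "b \<in> A" "c b \<in> T" using that by (auto simp: C_def)
      from subgroup.m_closed[OF T conjA[OF ab(1,4)] ab(2)]
      have "c (a \<otimes> b) \<in> T" using Ac[OF ab(1)] Ac[OF ab(3)] t by (simp add: c_def word_simps)
      then show ?thesis using subgroup.m_closed[OF A(2) ab(1,3)] by (simp add: C_def)
    qed
  qed
  have "c w = \<one>" if "w \<in> W" for w
    using step.prems[OF that step.hyps(5)] t Ac A(3) that by (auto simp: c_def word_simps)
  then have "W \<subseteq> C" using A(3) subgroup.one_closed[OF T] by (auto simp: C_def)
  moreover have "S \<subseteq> C"
    using S(2) generate.incl[of _ "derived G A \<union> c ` S" G] by (auto simp: C_def T_def)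
  ultimately have "A \<subseteq> C" using generate_subgroup_incl[OF _ C, of "W \<union> S"] S(3) by simp
  then have cT: "c a \<in> T" if "a \<in> A" for a using that by (auto simp: C_def)
  have "derived G (generate G (insert t A)) \<subseteq> T"
  proof (rule derived_generate_subset[OF T])
    show "insert t A \<subseteq> carrier G" using t Ac by blast
    fix x y assume x: "x \<in> insert t A" and y: "y \<in> T"
    then have yA: "y \<in> A" and yc: "y \<in> carrier G" using TA Ac by blast+
    show "x \<otimes> y \<otimes> inv x \<in> T"
    proof (cases "x = t")
      case True
      from subgroup.m_closed[OF T subgroup.m_inv_closed[OF T cT[OF yA]] y]
      show ?thesis using True t yc by (simp add: c_def word_simps)
    next
      case False
      with x y conjA show ?thesis by blast
    qed
    show "inv x \<otimes> y \<otimes> x \<in> T"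
    proof (cases "x = t")
      case True
      have "inv t \<otimes> y \<otimes> inv (inv t) \<in> A"
        by (rule step.hyps(4)[OF subgroup.m_inv_closed[OF step.hyps(2,5)] yA])
      from subgroup.m_closed[OF T cT[OF this] y]
      show ?thesis using True t yc by (simp add: c_def word_simps)
    next
      case False
      then have "x \<in> A" using x by simp
      with conjA[OF subgroup.m_inv_closed[OF A(2) this] y] Ac show ?thesis by simp
    qed
  next
    fix x y assume xy: "x \<in> insert t A" "y \<in> insert t A"
    show "x \<otimes> y \<otimes> inv x \<otimes> inv y \<in> T"
    proof (cases "x = t \<or> y = t")
      case False
      then show ?thesis using xy commutator_in_derived[of x A y] dAT by blast
    next
      case True
      then consider "x = t" "y = t" | "x = t" "y \<in> A" | "x \<in> A" "y = t" using xy by blast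
      then show ?thesis
      proof cases
        case 1
        then show ?thesis using t subgroup.one_closed[OF T] by (simp add: word_simps)
      next
        case 2
        from subgroup.m_inv_closed[OF T cT[OF 2(2)]] show ?thesis
          using 2 t Ac[OF 2(2)] by (simp add: c_def word_simps)
      next
        case 3
        then show ?thesis using cT[OF 3(1)] by (simp add: c_def)
      qed
    qed
  qed
  moreover have "B \<subseteq> generate G (insert t A)"
  proof
    have sub: "subgroup (generate G (insert t A)) G" using t Ac by (intro generate_is_subgroup) blast
    fix b assume "b \<in> B"
    then obtain i :: int and a where a: "a \<in> A" "b = a \<otimes> t [^] i"
      using step.hyps(6) unfolding r_coset_iff by blast
    have "a \<in> generate G (insert t A)" using a(1) by (intro generate.incl) simp
    moreover have "t [^] i \<in> generate G (insert t A)"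
      by (rule subgroup_int_pow_closed[OF sub]) (simp add: generate.incl)
    ultimately show "b \<in> generate G (insert t A)" using a(2) generate.eng by simp
  qed
  ultimately have "derived G B \<subseteq> T" using mono_derived by blast
  moreover have dB: "subgroup (derived G B) G" using Bc by (intro derived_is_subgroup) blast
  ultimately have "cyclic_series G ({\<one>} \<inter> derived G B) (derived G B)"
    using cyclic_series_mono[OF serT] by blast
  moreover have "{\<one>} \<inter> derived G B = {\<one>}" using subgroup.one_closed[OF dB] by blast
  ultimately show ?case by simp
qed

section \<open>Finite generation\<close>

text \<open>Schreier's lemma. Let \<open>M'\<close> be generated by the elements of \<open>M\<close> of the form \<open>t s t'\<inverse>\<close> with \<open>t, t'\<close> in the
  transversal and \<open>s\<close> a generator or the inverse of one. Then \<open>M' T\<close> is stable under right multiplication by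
  generators, so it is the whole group. To dispense with a transversal that meets \<open>M\<close> only in \<open>\<one>\<close>,
  the finitely many elements of \<open>T\<close> in \<open>M\<close> are added to the generators.\<close>
lemma (in group) finitely_generated_finite_index:
  assumes "finite S" "S \<subseteq> carrier G" and M: "subgroup M G" "M \<subseteq> generate G S"
    and T: "finite T" "T \<subseteq> generate G S" "\<And>l. l \<in> generate G S \<Longrightarrow> \<exists>t\<in>T. l \<otimes> inv t \<in> M"
  shows "\<exists>S'. finite S' \<and> S' \<subseteq> M \<and> generate G S' = M"
proof -
  let ?L = "generate G S"
  have L: "subgroup ?L G" by (rule generate_is_subgroup[OF assms(2)])
  note Lc = subgroup.mem_carrier[OF L]
  define T' where "T' = insert \<one> T"
  define E where "E = S \<union> (\<lambda>s. inv s) ` S"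
  define S' where "S' = M \<inter> (T' \<union> (\<lambda>(t, s, t'). t \<otimes> s \<otimes> inv t') ` (T' \<times> E \<times> T'))"
  have "finite S'" using assms(1) T(1) by (auto simp: S'_def T'_def E_def)
  have S'c: "S' \<subseteq> carrier G" using subgroup.subset[OF M(1)] by (auto simp: S'_def)
  let ?M = "generate G S'"
  have M': "subgroup ?M G" by (rule generate_is_subgroup[OF S'c])
  have T'L: "T' \<subseteq> ?L" using T(2) subgroup.one_closed[OF L] by (auto simp: T'_def)
  have EL: "e \<in> ?L" if "e \<in> E" for e
    using that by (auto simp: E_def intro: generate.incl generate.inv)
  define P where "P = {g. \<exists>m\<in>?M. \<exists>t\<in>T'. g = m \<otimes> t}"
  have stepE: "g \<otimes> e \<in> P" if g: "g \<in> P" and e: "e \<in> E" for g e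
  proof -
    obtain m t where m: "m \<in> ?M" "t \<in> T'" "g = m \<otimes> t" using g by (auto simp: P_def)
    have te: "t \<otimes> e \<in> ?L" using subgroup.m_closed[OF L] m(2) T'L EL[OF e] by blast
    obtain t' where t': "t' \<in> T" "t \<otimes> e \<otimes> inv t' \<in> M" using T(3)[OF te] by blast
    then have t'T: "t' \<in> T'" by (simp add: T'_def)
    then have "t \<otimes> e \<otimes> inv t' \<in> S'" using t' m(2) e by (force simp: S'_def)
    then have "m \<otimes> (t \<otimes> e \<otimes> inv t') \<in> ?M" using m(1) generate.incl generate.eng by metis
    moreover have "g \<otimes> e = m \<otimes> (t \<otimes> e \<otimes> inv t') \<otimes> t'"
      using m t'T T'L EL[OF e] Lc subgroup.mem_carrier[OF M' m(1)]
      by (auto simp: word_simps subset_iff)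
    ultimately show ?thesis using t'T unfolding P_def by blast
  qed
  have Pc: "g \<in> carrier G" if "g \<in> P" for g
    using that T'L Lc subgroup.mem_carrier[OF M'] by (auto simp: P_def)
  have step: "g \<otimes> l \<in> P" if "l \<in> ?L" "g \<in> P" for g l
    using that
  proof (induction arbitrary: g)
    case one then show ?case using Pc by simp
  next
    case (incl h) then show ?case using stepE by (auto simp: E_def)
  next
    case (inv h) then show ?case using stepE by (auto simp: E_def)
  next
    case (eng h1 h2)
    have "g \<otimes> h1 \<otimes> h2 \<in> P" using eng by blast
    then show ?case using Pc[OF eng.prems] Lc[OF eng.hyps(1)] Lc[OF eng.hyps(2)] by (simp add: m_assoc)
  qed
  have oneP: "\<one> \<in> P" unfolding P_def T'_def using subgroup.one_closed[OF M'] by force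
  have "m \<in> ?M" if "m \<in> M" for m
  proof -
    have mc: "m \<in> carrier G" using subgroup.mem_carrier[OF M(1) that] .
    have "m \<in> P" using step[OF _ oneP, of m] that M(2) mc by auto
    then obtain m' t where m': "m' \<in> ?M" "t \<in> T'" "m = m' \<otimes> t" by (auto simp: P_def)
    have "m' \<in> M"
      using m'(1) generate_subgroup_incl[OF _ M(1), of S'] by (auto simp: S'_def)
    then have "inv m' \<otimes> m \<in> M" using that M(1) by (simp add: subgroup.m_closed subgroup.m_inv_closed)
    moreover have "inv m' \<otimes> m = t"
      using m' T'L Lc subgroup.mem_carrier[OF M' m'(1)] by (auto simp: word_simps)
    ultimately have "t \<in> ?M" using m'(2) by (intro generate.incl) (auto simp: S'_def)
    then show ?thesis using m' generate.eng by simp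
  qed
  moreover have "?M \<subseteq> M" by (rule generate_subgroup_incl[OF _ M(1)]) (auto simp: S'_def)
  ultimately show ?thesis using \<open>finite S'\<close> by (intro exI[of _ S']) (auto simp: S'_def)
qed

definition word_product :: "('a, 'b) monoid_scheme \<Rightarrow> 'a list \<Rightarrow> 'a"
  where "word_product G w = foldr (\<otimes>\<^bsub>G\<^esub>) w \<one>\<^bsub>G\<^esub>"

context group
begin

lemma word_product_simps [simp]:
  "word_product G [] = \<one>" "word_product G (x # w) = x \<otimes> word_product G w"
  by (simp_all add: word_product_def)

lemma word_product_closed [simp]:
  "w \<in> lists (carrier G) \<Longrightarrow> word_product G w \<in> carrier G"
  by (induction w) auto

lemma word_product_append:
  "\<lbrakk>v \<in> lists (carrier G); w \<in> lists (carrier G)\<rbrakk>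
    \<Longrightarrow> word_product G (v @ w) = word_product G v \<otimes> word_product G w"
  by (induction v) (auto simp: m_assoc)

lemma generate_word_product:
  assumes "S \<subseteq> carrier G" "g \<in> generate G S"
  shows "\<exists>w\<in>lists (S \<union> (\<lambda>s. inv s) ` S). g = word_product G w"
  using assms(2)
proof induction
  case one
  show ?case by (intro bexI[of _ "[]"]) auto
next
  case (incl h)
  then show ?case using assms(1) by (intro bexI[of _ "[h]"]) auto
next
  case (inv h)
  then show ?case using assms(1) by (intro bexI[of _ "[inv h]"]) auto
next
  case (eng h1 h2)
  let ?E = "S \<union> (\<lambda>s. inv s) ` S"
  have E: "lists ?E \<subseteq> lists (carrier G)" using assms(1) by (intro lists_mono) auto
  from eng obtain v w where vw: "v \<in> lists ?E" "w \<in> lists ?E" "h1 = word_product G v" "h2 = word_product G w"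
    by blast
  then have "h1 \<otimes> h2 = word_product G (v @ w)" using word_product_append[OF subsetD[OF E] subsetD[OF E]] by simp
  moreover have "v @ w \<in> lists ?E" using vw by auto
  ultimately show ?case by blast
qed

text \<open>The closure condition says that of \<open>ug, u\<inverse>g\<close> both or neither are in \<open>Y\<close> whenever \<open>g\<close> is. It
  is a shadow of the identities \<open>(u - 1)\<^sup>2 = 0\<close>, that is \<open>u + u\<inverse> = 2\<close>, in a ring generated by units:
  there \<open>xy + yx = 2x + 2y - 2\<close>, so that modulo shorter words the letters anticommute and
  their squares vanish. Hence only words without repeated letters matter.\<close>
lemma distinct_words_suffice:
  assumes S: "S \<subseteq> carrier G"
    and refl: "\<And>u g. \<lbrakk>u \<in> carrier G; g \<in> carrier G; g \<in> Y; u \<otimes> g \<in> Y\<rbrakk> \<Longrightarrow> inv u \<otimes> g \<in> Y"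
    and dist: "\<And>w. \<lbrakk>w \<in> lists S; distinct w\<rbrakk> \<Longrightarrow> word_product G w \<in> Y"
    and "w \<in> lists S"
  shows "word_product G w \<in> Y"
proof -
  let ?p = "word_product G"
  have Sl: "lists S \<subseteq> lists (carrier G)" using S by (rule lists_mono)
  \<comment> \<open>The condition holds in the middle of a word as well, as seen by conjugating \<open>u\<close> with \<open>a\<close>.\<close>
  have mid: "a \<otimes> (inv u \<otimes> b) \<in> Y"
    if "a \<in> carrier G" "u \<in> carrier G" "b \<in> carrier G" "a \<otimes> b \<in> Y" "a \<otimes> (u \<otimes> b) \<in> Y" for a u b
    using refl[of "a \<otimes> u \<otimes> inv a" "a \<otimes> b"] that by (simp add: word_simps)
  have square: "a \<otimes> (x \<otimes> (x \<otimes> b)) \<in> Y"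
    if "a \<in> carrier G" "x \<in> carrier G" "b \<in> carrier G" "a \<otimes> b \<in> Y" "a \<otimes> (x \<otimes> b) \<in> Y" for a x b
    using mid[of a "inv x" "x \<otimes> b"] that by (simp add: word_simps)
  have swap: "a \<otimes> (x \<otimes> (y \<otimes> b)) \<in> Y"
    if car: "a \<in> carrier G" "x \<in> carrier G" "y \<in> carrier G" "b \<in> carrier G"
      and "a \<otimes> b \<in> Y" "a \<otimes> (x \<otimes> b) \<in> Y" "a \<otimes> (y \<otimes> b) \<in> Y" "a \<otimes> (y \<otimes> (x \<otimes> b)) \<in> Y" for a x y b
  proof -
    have 1: "a \<otimes> (y \<otimes> (inv x \<otimes> b)) \<in> Y"
      using mid[of "a \<otimes> y" x b] that by (simp add: m_assoc)
    have 2: "a \<otimes> (inv x \<otimes> b) \<in> Y" using mid[of a x b] that by simp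
    have 3: "a \<otimes> (inv y \<otimes> (inv x \<otimes> b)) \<in> Y" using mid[of a y "inv x \<otimes> b"] 1 2 car by simp
    show ?thesis using mid[of a "inv (x \<otimes> y)" b] 3 that by (simp add: word_simps)
  qed
  show ?thesis
    using assms(4)
  proof (induction w rule: length_induct)
    case (1 w)
    then have IH: "?p v \<in> Y" if "v \<in> lists S" "length v < length w" for v using that by blast
    show ?case
    proof (cases "distinct w")
      case True
      with dist 1 show ?thesis by blast
    next
      case False
      \<comment> \<open>Move the first \<open>x\<close> to the right until it meets the second one; each exchange costs
        membership of three shorter words only.\<close>
      then obtain p x q r where w: "w = p @ [x] @ q @ [x] @ r"
        using not_distinct_decomp by blast
      have "?p (p @ [x] @ q @ [x] @ r) \<in> Y"
        if "p @ [x] @ q @ [x] @ r \<in> lists S" "length (p @ [x] @ q @ [x] @ r) = length w" for p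
        using that
      proof (induction q arbitrary: p)
        case Nil
        have l: "p \<in> lists (carrier G)" "r \<in> lists (carrier G)" "x \<in> carrier G"
          using Nil(1) S by auto
        have "?p (p @ r) \<in> Y" "?p (p @ [x] @ r) \<in> Y" using Nil by (auto intro!: IH)
        then show ?case using square[of "?p p" x "?p r"] l by (simp add: word_product_append)
      next
        case (Cons y q)
        let ?b = "q @ [x] @ r"
        have l: "p \<in> lists (carrier G)" "?b \<in> lists (carrier G)" "x \<in> carrier G" "y \<in> carrier G"
          using Cons.prems(1) S by auto
        have "?p (p @ ?b) \<in> Y" "?p (p @ [x] @ ?b) \<in> Y" "?p (p @ [y] @ ?b) \<in> Y"
          using Cons.prems by (auto intro!: IH)
        moreover have "?p ((p @ [y]) @ [x] @ ?b) \<in> Y"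
          by (rule Cons.IH) (use Cons.prems in auto)
        ultimately show ?case
          using swap[of "?p p" x y "?p ?b"] l by (simp add: word_product_append)
      qed
      with 1 w show ?thesis by blast
    qed
  qed
qed

end

lemma (in group) generate_right_induct:
  assumes "S \<subseteq> carrier G" and "\<And>s. s \<in> S \<Longrightarrow> inv s \<in> S"
    and "\<one> \<in> P" "P \<subseteq> carrier G" and step: "\<And>g s. \<lbrakk>g \<in> P; s \<in> S\<rbrakk> \<Longrightarrow> g \<otimes> s \<in> P"
    and "g \<in> generate G S"
  shows "g \<in> P"
proof -
  have "\<forall>x\<in>P. x \<otimes> g \<in> P"
    using assms(6)
  proof induction
    case one
    then show ?case using assms(4) by (auto simp: subset_iff)
  next
    case (eng h1 h2)
    have "x \<otimes> (h1 \<otimes> h2) \<in> P" if "x \<in> P" for x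
    proof -
      have "x \<otimes> h1 \<otimes> h2 \<in> P" using eng that by blast
      then show ?thesis
        using that assms(4) eng.hyps generate_in_carrier[OF assms(1)] by (simp add: m_assoc subset_iff)
    qed
    then show ?case by blast
  qed (use assms(2) step in auto)
  then show ?thesis using assms(3) generate_in_carrier[OF assms(1,6)] by force
qed

section \<open>Two weakly commuting copies of a group\<close>

text \<open>All that is used of \<open>G = \<chi>(H)\<close>: it is generated by two copies of \<open>H\<close> whose corresponding elements commute,
  and it has the three homomorphisms to \<open>H\<close> described at the beginning.\<close>
locale weakly_commuting_copies = H: group H + G: group G
  for H :: "('a, 'b) monoid_scheme" and G :: "('c, 'd) monoid_scheme" (structure) +
  fixes i j :: "'a \<Rightarrow> 'c" and p q r :: "'c \<Rightarrow> 'a"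
  assumes i: "i \<in> hom H G" and j: "j \<in> hom H G"
    and p: "p \<in> hom G H" and q: "q \<in> hom G H" and r: "r \<in> hom G H"
    and commute: "x \<in> carrier H \<Longrightarrow> i x \<otimes> j x = j x \<otimes> i x"
    and generators: "generate G (i ` carrier H \<union> j ` carrier H) = carrier G"
    and p_i: "x \<in> carrier H \<Longrightarrow> p (i x) = x" and p_j: "x \<in> carrier H \<Longrightarrow> p (j x) = \<one>\<^bsub>H\<^esub>"
    and q_i: "x \<in> carrier H \<Longrightarrow> q (i x) = \<one>\<^bsub>H\<^esub>" and q_j: "x \<in> carrier H \<Longrightarrow> q (j x) = x"
    and r_i: "x \<in> carrier H \<Longrightarrow> r (i x) = x" and r_j: "x \<in> carrier H \<Longrightarrow> r (j x) = x"
begin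

sublocale i: group_hom H G i using i by unfold_locales
sublocale j: group_hom H G j using j by unfold_locales
sublocale p: group_hom G H p using p by unfold_locales
sublocale q: group_hom G H q using q by unfold_locales
sublocale r: group_hom G H r using r by unfold_locales

lemma generators_closed: "i ` carrier H \<union> j ` carrier H \<subseteq> carrier G"
  by auto

lemma generators_inv:
  "s \<in> i ` carrier H \<union> j ` carrier H \<Longrightarrow> inv s \<in> i ` carrier H \<union> j ` carrier H"
  by (auto simp flip: i.hom_inv j.hom_inv)

lemma right_induct [consumes 1, case_names one mult_i mult_j]:
  assumes "g \<in> carrier G" "P \<one>"
    and "\<And>g x. \<lbrakk>g \<in> carrier G; P g; x \<in> carrier H\<rbrakk> \<Longrightarrow> P (g \<otimes> i x)"
    and "\<And>g x. \<lbrakk>g \<in> carrier G; P g; x \<in> carrier H\<rbrakk> \<Longrightarrow> P (g \<otimes> j x)"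
  shows "P g"
proof -
  have "g \<in> {g \<in> carrier G. P g}"
    by (rule G.generate_right_induct[OF generators_closed generators_inv])
      (use assms generators in auto)
  then show ?thesis by simp
qed

definition \<delta> :: "'a \<Rightarrow> 'c" where "\<delta> x = inv (i x) \<otimes> j x"

text \<open>In the literature on weak commutativity this is the subgroup \<open>L(H)\<close>.\<close>
definition L :: "'c set" where "L = generate G (\<delta> ` carrier H)"

lemma \<delta>_closed [simp]: "x \<in> carrier H \<Longrightarrow> \<delta> x \<in> carrier G"
  by (simp add: \<delta>_def)

lemma \<delta>_in_L: "x \<in> carrier H \<Longrightarrow> \<delta> x \<in> L"
  unfolding L_def by (rule generate.incl) simp

lemma subgroup_L: "subgroup L G"
  unfolding L_def by (rule G.generate_is_subgroup) auto

lemma \<delta>_alt: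
  assumes "x \<in> carrier H"
  shows "\<delta> x = j x \<otimes> inv (i x)"
proof -
  have "inv (i x) \<otimes> (i x \<otimes> j x) \<otimes> inv (i x) = inv (i x) \<otimes> (j x \<otimes> i x) \<otimes> inv (i x)"
    using commute[OF assms] by simp
  then show ?thesis using assms by (simp add: \<delta>_def G.word_simps)
qed

lemma \<delta>_inv:
  assumes "x \<in> carrier H"
  shows "\<delta> (inv\<^bsub>H\<^esub> x) = inv (\<delta> x)"
proof -
  have "\<delta> (inv\<^bsub>H\<^esub> x) = i x \<otimes> inv (j x)"
    using assms by (simp add: \<delta>_def)
  also have "\<dots> = inv (\<delta> x)"
    using assms by (simp add: \<delta>_alt G.inv_mult_group)
  finally show ?thesis .
qed

lemma \<delta>_mult:
  assumes "x \<in> carrier H" "y \<in> carrier H"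
  shows "\<delta> (x \<otimes>\<^bsub>H\<^esub> y) = inv (i y) \<otimes> \<delta> x \<otimes> i y \<otimes> \<delta> y"
  using assms by (simp add: \<delta>_def G.word_simps)

text \<open>By \<open>\<delta>_mult\<close> and \<open>\<delta>_inv\<close> the factors \<open>\<delta> (u g) (\<delta> g)\<inverse>\<close> and \<open>\<delta> (u\<inverse> g) (\<delta> g)\<inverse>\<close> are conjugates of
  \<open>\<delta> u\<close> and of \<open>(\<delta> u)\<inverse>\<close> by the same element \<open>i g\<close>, so they are inverse to each other.\<close>
lemma \<delta>_reflect:
  assumes "u \<in> carrier H" "g \<in> carrier H"
  shows "\<delta> (inv\<^bsub>H\<^esub> u \<otimes>\<^bsub>H\<^esub> g) = \<delta> g \<otimes> inv (\<delta> (u \<otimes>\<^bsub>H\<^esub> g)) \<otimes> \<delta> g"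
  using assms by (simp add: \<delta>_mult \<delta>_inv G.word_simps)

text \<open>For a subgroup \<open>B\<close>, the set of all \<open>x\<close> with \<open>\<delta> x\<close> in \<open>B\<close> satisfies the closure condition of
  \<open>distinct_words_suffice\<close> by \<open>\<delta>_reflect\<close>.\<close>
lemma L_finitely_generated:
  assumes "finite S" "S \<subseteq> carrier H" "generate H S = carrier H"
  shows "\<exists>F. finite F \<and> F \<subseteq> L \<and> generate G F = L"
proof -
  define E where "E = S \<union> (\<lambda>s. inv\<^bsub>H\<^esub> s) ` S"
  have E: "finite E" "E \<subseteq> carrier H" using assms(1,2) by (auto simp: E_def)
  define W where "W = {w \<in> lists E. distinct w}"
  have "W = {w. set w \<subseteq> E \<and> distinct w}" by (auto simp: W_def)
  then have fin: "finite W" using finite_subset_distinct[OF E(1)] by simp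
  define F where "F = \<delta> ` word_product H ` W"
  have wc: "word_product H w \<in> carrier H" if "w \<in> lists E" for w
    using that E(2) H.word_product_closed by (meson lists_mono subsetD)
  have FL: "F \<subseteq> L" using wc \<delta>_in_L by (auto simp: F_def W_def)
  have B: "subgroup (generate G F) G"
    using FL subgroup.subset[OF subgroup_L] by (intro G.generate_is_subgroup) blast
  have "\<delta> ` carrier H \<subseteq> generate G F"
  proof
    fix l assume "l \<in> \<delta> ` carrier H"
    then obtain h where h: "h \<in> carrier H" "l = \<delta> h" by blast
    then obtain w where w: "w \<in> lists E" "h = word_product H w"
      using H.generate_word_product[OF assms(2), of h] assms(3) by (auto simp: E_def)
    have "word_product H w \<in> {x. \<delta> x \<in> generate G F}"
    proof (rule H.distinct_words_suffice[OF E(2) _ _ w(1)])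
      show "word_product H w \<in> {x. \<delta> x \<in> generate G F}" if "w \<in> lists E" "distinct w" for w
        using that by (auto simp: F_def W_def intro: generate.incl)
      show "inv\<^bsub>H\<^esub> u \<otimes>\<^bsub>H\<^esub> g \<in> {x. \<delta> x \<in> generate G F}"
        if "u \<in> carrier H" "g \<in> carrier H" "g \<in> {x. \<delta> x \<in> generate G F}"
          "u \<otimes>\<^bsub>H\<^esub> g \<in> {x. \<delta> x \<in> generate G F}" for u g
        using that B by (simp add: \<delta>_reflect subgroup.m_closed subgroup.m_inv_closed)
    qed
    with h w show "l \<in> generate G F" by simp
  qed
  then have "L \<subseteq> generate G F" unfolding L_def by (rule G.generate_subgroup_incl[OF _ B])
  moreover have "generate G F \<subseteq> L" by (rule G.generate_subgroup_incl[OF FL subgroup_L])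
  ultimately show ?thesis using fin FL unfolding F_def by (intro exI conjI) auto
qed

lemma conj_\<delta>:
  assumes "x \<in> carrier H" "k \<in> carrier H"
  shows "i k \<otimes> \<delta> x \<otimes> inv (i k) = \<delta> (x \<otimes>\<^bsub>H\<^esub> inv\<^bsub>H\<^esub> k) \<otimes> inv (\<delta> (inv\<^bsub>H\<^esub> k))"
  using assms by (simp add: \<delta>_def G.word_simps)

text \<open>The copy \<open>i(H)\<close> normalises \<open>L\<close> by \<open>conj_\<delta>\<close>, and \<open>j x = i x \<delta> x\<close>.\<close>
lemma L_normal: "L \<lhd> G"
proof (rule G.normal_invI[OF subgroup_L])
  note Lc = subgroup.mem_carrier[OF subgroup_L]
  have conj_i: "i k \<otimes> l \<otimes> inv (i k) \<in> L" if "k \<in> carrier H" "l \<in> L" for k l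
    using that(2) unfolding L_def
  proof induction
    case one
    then show ?case using that by (simp add: generate.one)
  next
    case (incl h)
    then obtain x where x: "x \<in> carrier H" "h = \<delta> x" by blast
    have "\<delta> (x \<otimes>\<^bsub>H\<^esub> inv\<^bsub>H\<^esub> k) \<otimes> inv (\<delta> (inv\<^bsub>H\<^esub> k)) \<in> generate G (\<delta> ` carrier H)"
      using x that(1) by (intro generate.eng generate.incl generate.inv) auto
    then show ?case using conj_\<delta>[OF x(1) that(1)] x by simp
  next
    case (inv h)
    then obtain x where x: "x \<in> carrier H" "h = \<delta> x" by blast
    have "inv (\<delta> (x \<otimes>\<^bsub>H\<^esub> inv\<^bsub>H\<^esub> k) \<otimes> inv (\<delta> (inv\<^bsub>H\<^esub> k))) \<in> L"
      using x that(1) subgroup_L by (simp add: subgroup.m_closed subgroup.m_inv_closed \<delta>_in_L)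
    then have "inv (i k \<otimes> h \<otimes> inv (i k)) \<in> L" using conj_\<delta>[OF x(1) that(1)] x by simp
    moreover have "inv (i k \<otimes> h \<otimes> inv (i k)) = i k \<otimes> inv h \<otimes> inv (i k)"
      using x that(1) by (simp add: G.word_simps)
    ultimately show ?case by (simp add: L_def)
  next
    case (eng h1 h2)
    then have "h1 \<in> L" "h2 \<in> L" by (auto simp: L_def)
    then show ?case
      using generate.eng[OF eng.IH] Lc that(1) by (simp add: G.word_simps)
  qed
  fix g l assume "g \<in> carrier G" "l \<in> L"
  then show "g \<otimes> l \<otimes> inv g \<in> L"
  proof (induction arbitrary: l rule: right_induct)
    case one
    then show ?case using Lc by simp
  next
    case (mult_i g x)
    from mult_i.IH[OF conj_i[OF mult_i.hyps(2) mult_i.prems]] show ?case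
      using mult_i.hyps Lc[OF mult_i.prems] by (simp add: G.word_simps)
  next
    case (mult_j g x)
    let ?l = "\<delta> x \<otimes> l \<otimes> inv (\<delta> x)"
    have "?l \<in> L" using mult_j \<delta>_in_L subgroup_L by (simp add: subgroup.m_closed subgroup.m_inv_closed)
    from mult_j.IH[OF conj_i[OF mult_j.hyps(2) this]] show ?case
      using mult_j.hyps Lc[OF mult_j.prems] by (simp add: \<delta>_def G.word_simps)
  qed
qed

text \<open>Modulo \<open>L\<close> the two copies coincide, so every \<open>g\<close> is congruent to \<open>i (r g)\<close>.\<close>
lemma kernel_r_subset_L:
  assumes "g \<in> carrier G" "r g = \<one>\<^bsub>H\<^esub>"
  shows "g \<in> L"
proof -
  note Lc = subgroup.mem_carrier[OF subgroup_L]
  interpret L: normal L G by (rule L_normal)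
  have "inv (i (r g)) \<otimes> g \<in> L"
    using assms(1)
  proof (induction rule: right_induct)
    case one
    then show ?case by (simp add: subgroup.one_closed[OF subgroup_L])
  next
    case (mult_i g x)
    from L.inv_op_closed1[OF i.hom_closed[OF mult_i.hyps(2)] mult_i.IH]
    show ?case using mult_i.hyps by (simp add: r_i G.word_simps)
  next
    case (mult_j g x)
    from subgroup.m_closed[OF subgroup_L L.inv_op_closed1[OF i.hom_closed[OF mult_j.hyps(2)] mult_j.IH] \<delta>_in_L[OF mult_j.hyps(2)]]
    show ?case using mult_j.hyps by (simp add: r_j \<delta>_def G.word_simps)
  qed
  then show ?thesis using assms by simp
qed

definition \<kappa> :: "'a \<Rightarrow> 'a \<Rightarrow> 'c" where "\<kappa> x y = inv (i x) \<otimes> j y \<otimes> i x \<otimes> inv (j y)"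

lemma \<kappa>_closed [simp]: "\<lbrakk>x \<in> carrier H; y \<in> carrier H\<rbrakk> \<Longrightarrow> \<kappa> x y \<in> carrier G"
  by (simp add: \<kappa>_def)

text \<open>This is the relation that \<open>i (x y)\<close> and \<open>j (x y)\<close> commute, solved for the mixed terms.\<close>
lemma \<kappa>_swap:
  assumes "x \<in> carrier H" "y \<in> carrier H"
  shows "\<kappa> x y = inv (j x) \<otimes> i y \<otimes> j x \<otimes> inv (i y)"
proof -
  have "inv (j x) \<otimes> i y \<otimes> j x \<otimes> inv (i y)
      = inv (j x) \<otimes> inv (i x) \<otimes> (i (x \<otimes>\<^bsub>H\<^esub> y) \<otimes> j (x \<otimes>\<^bsub>H\<^esub> y)) \<otimes> inv (j y) \<otimes> inv (i y)"
    using assms by (simp add: G.word_simps)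
  also have "\<dots> = inv (i x \<otimes> j x) \<otimes> (j (x \<otimes>\<^bsub>H\<^esub> y) \<otimes> i (x \<otimes>\<^bsub>H\<^esub> y)) \<otimes> inv (i y \<otimes> j y)"
    using assms commute[of "x \<otimes>\<^bsub>H\<^esub> y"] by (simp add: G.m_assoc G.inv_mult_group)
  also have "\<dots> = inv (j x \<otimes> i x) \<otimes> (j (x \<otimes>\<^bsub>H\<^esub> y) \<otimes> i (x \<otimes>\<^bsub>H\<^esub> y)) \<otimes> inv (j y \<otimes> i y)"
    using assms by (simp only: commute)
  also have "\<dots> = \<kappa> x y"
    using assms by (simp add: \<kappa>_def G.word_simps)
  finally show ?thesis by simp
qed

text \<open>Expanding \<open>\<kappa> (x z) y\<close> once with each of the two expressions for \<open>\<kappa>\<close> shows that conjugation by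
  \<open>i z\<close> and by \<open>j z\<close> have the same effect on \<open>\<kappa> x y\<close>.\<close>
lemma \<kappa>_commutes_\<delta>:
  assumes "x \<in> carrier H" "y \<in> carrier H" "z \<in> carrier H"
  shows "\<kappa> x y \<otimes> \<delta> z = \<delta> z \<otimes> \<kappa> x y"
proof -
  have "\<kappa> (x \<otimes>\<^bsub>H\<^esub> z) y = inv (i z) \<otimes> \<kappa> x y \<otimes> i z \<otimes> \<kappa> z y"
    using assms by (simp add: \<kappa>_def G.word_simps)
  moreover have "\<kappa> (x \<otimes>\<^bsub>H\<^esub> z) y = inv (j z) \<otimes> \<kappa> x y \<otimes> j z \<otimes> \<kappa> z y"
    using assms by (simp add: \<kappa>_swap G.word_simps)
  ultimately have eq: "inv (i z) \<otimes> \<kappa> x y \<otimes> i z = inv (j z) \<otimes> \<kappa> x y \<otimes> j z"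
    using assms by simp
  then have "j z \<otimes> (inv (i z) \<otimes> \<kappa> x y \<otimes> i z) \<otimes> inv (i z)
      = j z \<otimes> (inv (j z) \<otimes> \<kappa> x y \<otimes> j z) \<otimes> inv (i z)"
    by simp
  then have "j z \<otimes> inv (i z) \<otimes> \<kappa> x y = \<kappa> x y \<otimes> (j z \<otimes> inv (i z))"
    using assms by (simp add: G.word_simps)
  then show ?thesis by (simp only: \<delta>_alt[OF assms(3)])
qed

text \<open>A normal subgroup that contains all \<open>\<kappa> x y\<close>. The condition on \<open>p\<close> and \<open>q\<close> is built in so that
  the factorisation below is unique and identifies it with the common kernel of \<open>p\<close> and \<open>q\<close>.\<close>
definition D :: "'c set"
  where "D = {g \<in> carrier G. p g = \<one>\<^bsub>H\<^esub> \<and> q g = \<one>\<^bsub>H\<^esub> \<and> (\<forall>l\<in>L. g \<otimes> l = l \<otimes> g)}"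

lemma \<kappa>_in_D:
  assumes "x \<in> carrier H" "y \<in> carrier H"
  shows "\<kappa> x y \<in> D"
proof -
  have "p (\<kappa> x y) = \<one>\<^bsub>H\<^esub>" "q (\<kappa> x y) = \<one>\<^bsub>H\<^esub>"
    using assms by (auto simp: \<kappa>_def p_i p_j q_i q_j)
  moreover have "\<kappa> x y \<otimes> l = l \<otimes> \<kappa> x y" if "l \<in> L" for l
    using that unfolding L_def
  proof induction
    case one
    then show ?case using assms by simp
  next
    case (incl h)
    then show ?case using \<kappa>_commutes_\<delta>[OF assms] by blast
  next
    case (inv h)
    then obtain z where z: "z \<in> carrier H" "h = \<delta> z" by blast
    have "inv h \<otimes> (\<kappa> x y \<otimes> h) \<otimes> inv h = inv h \<otimes> (h \<otimes> \<kappa> x y) \<otimes> inv h"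
      using \<kappa>_commutes_\<delta>[OF assms z(1)] z by simp
    then show ?case using assms z by (simp add: G.word_simps)
  next
    case (eng h1 h2)
    then have "h1 \<in> carrier G" "h2 \<in> carrier G"
      using subgroup.mem_carrier[OF subgroup_L] by (auto simp: L_def)
    with eng assms show ?case by (metis G.m_assoc \<kappa>_closed)
  qed
  ultimately show ?thesis using assms by (simp add: D_def)
qed

lemma conj_D:
  assumes "g \<in> carrier G" "d \<in> D"
  shows "g \<otimes> d \<otimes> inv g \<in> D"
proof -
  interpret L: normal L G by (rule L_normal)
  have d: "d \<in> carrier G" "p d = \<one>\<^bsub>H\<^esub>" "q d = \<one>\<^bsub>H\<^esub>" using assms(2) by (auto simp: D_def)
  have "g \<otimes> d \<otimes> inv g \<otimes> l = l \<otimes> (g \<otimes> d \<otimes> inv g)" if "l \<in> L" for l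
  proof -
    have lc: "l \<in> carrier G" using that L.mem_carrier by blast
    have "inv g \<otimes> l \<otimes> g \<in> L" using L.inv_op_closed1[OF assms(1) that] .
    then have "d \<otimes> (inv g \<otimes> l \<otimes> g) = (inv g \<otimes> l \<otimes> g) \<otimes> d" using assms(2) by (simp add: D_def)
    then have "g \<otimes> (d \<otimes> (inv g \<otimes> l \<otimes> g)) \<otimes> inv g = g \<otimes> ((inv g \<otimes> l \<otimes> g) \<otimes> d) \<otimes> inv g" by simp
    then show ?thesis using assms(1) d lc by (simp add: G.word_simps)
  qed
  then show ?thesis using assms(1) d by (simp add: D_def)
qed

lemma D_mult:
  assumes "d \<in> D" "e \<in> D"
  shows "d \<otimes> e \<in> D"
proof -
  have "d \<otimes> e \<otimes> l = l \<otimes> (d \<otimes> e)" if "l \<in> L" for l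
    using assms that subgroup.mem_carrier[OF subgroup_L that] unfolding D_def
    by (smt (verit) G.m_assoc mem_Collect_eq)
  then show ?thesis using assms by (auto simp: D_def)
qed

text \<open>Modulo \<open>D\<close> the two copies of \<open>H\<close> commute, so a product of elements of them can be sorted.\<close>
lemma factorisation:
  assumes "g \<in> carrier G"
  shows "\<exists>d\<in>D. \<exists>x\<in>carrier H. \<exists>y\<in>carrier H. g = d \<otimes> i x \<otimes> j y"
  using assms
proof (induction rule: right_induct)
  case one
  have "\<one> \<in> D" using subgroup.mem_carrier[OF subgroup_L] by (auto simp: D_def)
  then show ?case by (intro bexI[of _ "\<one>"] bexI[of _ "\<one>\<^bsub>H\<^esub>"]) auto
next
  case (mult_i g z)
  from mult_i.IH obtain d x y where g: "d \<in> D" "x \<in> carrier H" "y \<in> carrier H" "g = d \<otimes> i x \<otimes> j y" by blast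
  have dc: "d \<in> carrier G" using g(1) by (simp add: D_def)
  let ?u = "i (x \<otimes>\<^bsub>H\<^esub> z)"
  have "d \<otimes> (?u \<otimes> \<kappa> z y \<otimes> inv ?u) \<in> D"
    using g mult_i.hyps by (intro D_mult conj_D \<kappa>_in_D) auto
  moreover have "g \<otimes> i z = d \<otimes> (?u \<otimes> \<kappa> z y \<otimes> inv ?u) \<otimes> ?u \<otimes> j y"
    using g mult_i.hyps dc by (simp add: \<kappa>_def G.word_simps)
  ultimately show ?case using g mult_i.hyps H.m_closed by blast
next
  case (mult_j g z)
  from mult_j.IH obtain d x y where g: "d \<in> D" "x \<in> carrier H" "y \<in> carrier H" "g = d \<otimes> i x \<otimes> j y" by blast
  have dc: "d \<in> carrier G" using g(1) by (simp add: D_def)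
  have "g \<otimes> j z = d \<otimes> i x \<otimes> j (y \<otimes>\<^bsub>H\<^esub> z)"
    using g mult_j.hyps dc by (simp add: G.m_assoc)
  then show ?case using g mult_j.hyps H.m_closed by blast
qed

definition W :: "'c set"
  where "W = {g \<in> carrier G. p g = \<one>\<^bsub>H\<^esub> \<and> q g = \<one>\<^bsub>H\<^esub> \<and> r g = \<one>\<^bsub>H\<^esub>}"

lemma W_subset_L: "W \<subseteq> L"
  using kernel_r_subset_L by (auto simp: W_def)

lemma W_central:
  assumes "w \<in> W" "l \<in> L"
  shows "w \<otimes> l = l \<otimes> w"
proof -
  have w: "w \<in> carrier G" "p w = \<one>\<^bsub>H\<^esub>" "q w = \<one>\<^bsub>H\<^esub>" using assms(1) by (auto simp: W_def)
  obtain d x y where f: "d \<in> D" "x \<in> carrier H" "y \<in> carrier H" "w = d \<otimes> i x \<otimes> j y"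
    using factorisation[OF w(1)] by blast
  then have "d \<in> carrier G" "p d = \<one>\<^bsub>H\<^esub>" "q d = \<one>\<^bsub>H\<^esub>" by (auto simp: D_def)
  then have "x = \<one>\<^bsub>H\<^esub>" "y = \<one>\<^bsub>H\<^esub>"
    using w f by (auto simp: p_i p_j q_i q_j)
  then have "w = d" using f \<open>d \<in> carrier G\<close> by simp
  then show ?thesis using f(1) assms(2) by (simp add: D_def)
qed

text \<open>The argument of the introduction, with \<open>M = N \<inter> L\<close>.\<close>
theorem polycyclic_finite_index:
  assumes P: "P \<lhd> H" "cyclic_series H {\<one>\<^bsub>H\<^esub>} P" "finite (rcosets\<^bsub>H\<^esub> P)"
  defines "N \<equiv> {g \<in> carrier G. p g \<in> P \<and> q g \<in> P \<and> r g \<in> P}"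
  shows "N \<lhd> G" "cyclic_series G {\<one>} N" "finite (rcosets N)"
proof -
  interpret P: normal P H by (rule P(1))
  have subN: "subgroup N G"
  proof (rule G.subgroupI)
    have "\<one> \<in> N" by (simp add: N_def)
    then show "N \<noteq> {}" by blast
  qed (auto simp: N_def)
  show N: "N \<lhd> G"
    by (rule G.normal_invI[OF subN]) (auto simp: N_def P.inv_op_closed2)
  define f where "f g = (P #>\<^bsub>H\<^esub> p g, P #>\<^bsub>H\<^esub> q g, P #>\<^bsub>H\<^esub> r g)" for g
  have ffin: "finite (f ` A)" if "A \<subseteq> carrier G" for A
  proof (rule finite_subset)
    show "f ` A \<subseteq> (rcosets\<^bsub>H\<^esub> P) \<times> (rcosets\<^bsub>H\<^esub> P) \<times> (rcosets\<^bsub>H\<^esub> P)"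
      using that by (auto simp: f_def subset_iff intro!: H.rcosetsI P.subset)
    show "finite ((rcosets\<^bsub>H\<^esub> P) \<times> (rcosets\<^bsub>H\<^esub> P) \<times> (rcosets\<^bsub>H\<^esub> P))" using P(3) by simp
  qed
  have quot: "x \<otimes>\<^bsub>H\<^esub> inv\<^bsub>H\<^esub> y \<in> P"
    if "P #>\<^bsub>H\<^esub> x = P #>\<^bsub>H\<^esub> y" "x \<in> carrier H" "y \<in> carrier H" for x y
    using P.rcos_module_imp[OF H.is_group that(3)] H.rcos_self[OF that(2) P.subgroup_axioms] that(1) by simp
  have transversal: "\<exists>T. finite T \<and> T \<subseteq> A \<and> (\<forall>g\<in>A. \<exists>t\<in>T. g \<otimes> inv t \<in> N)"
    if A: "A \<subseteq> carrier G" for A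
  proof -
    obtain T where T: "T \<subseteq> A" "finite T" "f ` A = f ` T"
      using finite_subset_image[OF ffin[OF A] subset_refl] by blast
    have "\<exists>t\<in>T. g \<otimes> inv t \<in> N" if "g \<in> A" for g
    proof -
      have "f g \<in> f ` T" using that T(3) by blast
      then obtain t where t: "t \<in> T" "f g = f t" by blast
      have c: "g \<in> carrier G" "t \<in> carrier G" using A T(1) that t(1) by auto
      then have "g \<otimes> inv t \<in> N"
        using t(2) quot[of "p g" "p t"] quot[of "q g" "q t"] quot[of "r g" "r t"]
        by (simp add: f_def N_def)
      with t(1) show ?thesis by blast
    qed
    with T show ?thesis by blast
  qed
  show "finite (rcosets N)"
  proof -
    obtain T where T: "finite T" "T \<subseteq> carrier G" "\<forall>g\<in>carrier G. \<exists>t\<in>T. g \<otimes> inv t \<in> N"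
      using transversal[OF subset_refl] by blast
    have "rcosets N \<subseteq> (\<lambda>t. N #> t) ` T"
    proof
      fix c assume "c \<in> rcosets N"
      then obtain g where g: "g \<in> carrier G" "c = N #> g" by (auto simp: RCOSETS_def)
      then obtain t where t: "t \<in> T" "g \<otimes> inv t \<in> N" using T(3) by blast
      then have "g \<in> N #> t"
        using g(1) T(2) by (intro G.r_coset_iff[THEN iffD2] bexI[of _ "g \<otimes> inv t"]) (auto simp: G.word_simps)
      then have "N #> t = c"
        using G.repr_independence[OF _ _ subN] T(2) t(1) g(2) by blast
      with t(1) show "c \<in> (\<lambda>t. N #> t) ` T" by blast
    qed
    then show ?thesis using T(1) finite_subset by blast
  qed
  have pull: "cyclic_series G {g \<in> A. s g = \<one>\<^bsub>H\<^esub>} A"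
    if "s \<in> hom G H" "subgroup A G" "s ` A \<subseteq> P" for s A
    using cyclic_series_vimage[OF P(2) G.is_group H.is_group that] by simp
  define N\<^sub>1 where "N\<^sub>1 = {g \<in> N. r g = \<one>\<^bsub>H\<^esub>}"
  define N\<^sub>2 where "N\<^sub>2 = {g \<in> N\<^sub>1. q g = \<one>\<^bsub>H\<^esub>}"
  have s1: "cyclic_series G N\<^sub>1 N"
    unfolding N\<^sub>1_def by (rule pull[OF r subN]) (auto simp: N_def)
  have s2: "cyclic_series G N\<^sub>2 N\<^sub>1"
    unfolding N\<^sub>2_def
    by (rule pull[OF q cyclic_series_subgroup(1)[OF s1]]) (auto simp: N_def N\<^sub>1_def)
  have "cyclic_series G {g \<in> N\<^sub>2. p g = \<one>\<^bsub>H\<^esub>} N\<^sub>2"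
    by (rule pull[OF p cyclic_series_subgroup(1)[OF s2]]) (auto simp: N_def N\<^sub>1_def N\<^sub>2_def)
  moreover have "{g \<in> N\<^sub>2. p g = \<one>\<^bsub>H\<^esub>} = W"
    by (auto simp: N\<^sub>2_def N\<^sub>1_def N_def W_def)
  ultimately have WN: "cyclic_series G W N"
    using s1 s2 cyclic_series_trans by metis
  have H_fg: "\<exists>S. finite S \<and> S \<subseteq> carrier H \<and> generate H S = carrier H"
  proof -
    obtain S where S: "finite S" "S \<subseteq> P" "generate H ({\<one>\<^bsub>H\<^esub>} \<union> S) = P"
      using H.cyclic_series_imp_finitely_generated[OF P(2)] by blast
    have "rcosets\<^bsub>H\<^esub> P = (\<lambda>h. P #>\<^bsub>H\<^esub> h) ` carrier H" by (auto simp: RCOSETS_def)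
    then have "finite ((\<lambda>h. P #>\<^bsub>H\<^esub> h) ` carrier H)" using P(3) by simp
    from finite_subset_image[OF this subset_refl]
    obtain T where T: "T \<subseteq> carrier H" "finite T"
      "(\<lambda>h. P #>\<^bsub>H\<^esub> h) ` carrier H = (\<lambda>h. P #>\<^bsub>H\<^esub> h) ` T"
      by blast
    let ?S = "{\<one>\<^bsub>H\<^esub>} \<union> S \<union> T"
    have Sc: "?S \<subseteq> carrier H" using S(2) T(1) P.subset by auto
    have "h \<in> generate H ?S" if h: "h \<in> carrier H" for h
    proof -
      have "P #>\<^bsub>H\<^esub> h \<in> (\<lambda>h. P #>\<^bsub>H\<^esub> h) ` T" using T(3) h by blast
      then obtain t where t: "t \<in> T" "P #>\<^bsub>H\<^esub> h = P #>\<^bsub>H\<^esub> t" by blast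
      have tc: "t \<in> carrier H" using t(1) T(1) by blast
      have "h \<otimes>\<^bsub>H\<^esub> inv\<^bsub>H\<^esub> t \<in> generate H ?S"
        using quot[OF t(2) h tc] S(3) H.mono_generate[of "{\<one>\<^bsub>H\<^esub>} \<union> S" ?S] by blast
      moreover have "t \<in> generate H ?S" using t(1) by (intro generate.incl) simp
      ultimately have "h \<otimes>\<^bsub>H\<^esub> inv\<^bsub>H\<^esub> t \<otimes>\<^bsub>H\<^esub> t \<in> generate H ?S" by (rule generate.eng)
      then show ?thesis using h tc by (simp add: H.word_simps)
    qed
    then have "generate H ?S = carrier H" using H.generate_incl[OF Sc] by blast
    then show ?thesis using Sc S(1) T(2) by (intro exI[of _ ?S]) simp
  qed
  from H_fg obtain S\<^sub>H where "finite S\<^sub>H" "S\<^sub>H \<subseteq> carrier H" "generate H S\<^sub>H = carrier H" by blast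
  from L_finitely_generated[OF this]
  obtain F where F: "finite F" "F \<subseteq> L" "generate G F = L" by blast
  define M where "M = N \<inter> L"
  have M: "subgroup M G" unfolding M_def by (rule G.subgroups_Inter_pair[OF subN subgroup_L])
  have WM: "W \<subseteq> M"
    using W_subset_L cyclic_series_subgroup(3)[OF WN] by (auto simp: M_def)
  have serM: "cyclic_series G W M"
    using G.cyclic_series_mono[OF WN M] WM by (simp add: M_def Int_absorb2)
  have serdM: "cyclic_series G {\<one>} (derived G M)"
    by (rule G.derived_polycyclic_of_central_by_polycyclic[OF serM]) (use W_central in \<open>auto simp: M_def\<close>)
  have Lc: "L \<subseteq> carrier G" by (rule subgroup.subset[OF subgroup_L])
  obtain T where T: "finite T" "T \<subseteq> L" "\<forall>g\<in>L. \<exists>t\<in>T. g \<otimes> inv t \<in> N"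
    using transversal[OF Lc] by blast
  have "\<exists>S. finite S \<and> S \<subseteq> M \<and> generate G S = M"
  proof (rule G.finitely_generated_finite_index[OF F(1) _ M _ T(1)])
    show "F \<subseteq> carrier G" using F(2) Lc by auto
    show "M \<subseteq> generate G F" "T \<subseteq> generate G F" using F(3) T(2) by (auto simp: M_def)
    show "\<exists>t\<in>T. l \<otimes> inv t \<in> M" if "l \<in> generate G F" for l
    proof -
      have l: "l \<in> L" using that F(3) by simp
      then obtain t where t: "t \<in> T" "l \<otimes> inv t \<in> N" using T(3) by blast
      have "l \<otimes> inv t \<in> L"
        using l t(1) T(2) subgroup_L by (auto simp: subgroup.m_closed subgroup.m_inv_closed)
      with t show ?thesis by (auto simp: M_def)
    qed
  qed
  then obtain S where S: "finite S" "S \<subseteq> M" "generate G S = M" by blast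
  have Mc: "M \<subseteq> carrier G" by (rule subgroup.subset[OF M])
  have dM: "derived G M \<subseteq> M" by (rule G.derived_incl[OF _ M]) simp
  have genM: "generate G (derived G M \<union> S) = M"
  proof
    show "generate G (derived G M \<union> S) \<subseteq> M" using dM S(2) by (intro G.generate_subgroup_incl[OF _ M]) blast
    show "M \<subseteq> generate G (derived G M \<union> S)" using S(3) G.mono_generate[of S "derived G M \<union> S"] by blast
  qed
  have "cyclic_series G (derived G M) (generate G (derived G M \<union> S))"
    by (rule G.cyclic_series_abelian_extension[OF S(1)])
      (use S(2) Mc genM G.derived_is_subgroup[OF Mc] in auto)
  then have "cyclic_series G {\<one>} M"
    using cyclic_series_trans[OF serdM] genM by simp
  then have "cyclic_series G ({\<one>} \<inter> W) W"
    using G.cyclic_series_mono cyclic_series_subgroup(1)[OF WN] WM by blast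
  moreover have "{\<one>} \<inter> W = {\<one>}" by (auto simp: W_def)
  ultimately show "cyclic_series G {\<one>} N"
    using cyclic_series_trans WN by simp
qed

end

section \<open>The universal property of the weak commutativity group\<close>

text \<open>The abstract situation above is realised by \<open>\<chi> H\<close>.\<close>
locale weak_commutativity = H: group H for H :: "('a, 'b) monoid_scheme"
begin

abbreviation "FP \<equiv> free_product H H"
abbreviation "R \<equiv> normal_closure FP (weak_commutators H)"

definition left :: "'a \<Rightarrow> ('a + 'a) list set set" where "left x = R #>\<^bsub>FP\<^esub> fp_inl H H x"
definition right :: "'a \<Rightarrow> ('a + 'a) list set set" where "right x = R #>\<^bsub>FP\<^esub> fp_inr H H x"

sublocale FP: group FP
  by (rule group_free_product) (rule H.is_group)+

sublocale R: normal R FP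
  by (rule normal_closure_normal[OF FP.is_group weak_commutators_carrier[OF H.is_group]])

sublocale \<chi>: group "\<chi> H"
  by (rule group_weak_commutativity_group[OF H.is_group])

lemma proj_hom: "(\<lambda>a. R #>\<^bsub>FP\<^esub> a) \<in> hom FP (\<chi> H)"
  unfolding weak_commutativity_group_def by (rule R.r_coset_hom_Mod)

lemma left_hom: "left \<in> hom H (\<chi> H)"
  using hom_compose[OF fp_inl_hom[OF H.is_group H.is_group] proj_hom]
  by (simp add: left_def[abs_def] comp_def)

lemma right_hom: "right \<in> hom H (\<chi> H)"
  using hom_compose[OF fp_inr_hom[OF H.is_group H.is_group] proj_hom]
  by (simp add: right_def[abs_def] comp_def)

sublocale left: group_hom H "\<chi> H" left using left_hom by unfold_locales
sublocale right: group_hom H "\<chi> H" right using right_hom by unfold_locales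
sublocale proj: group_hom FP "\<chi> H" "\<lambda>a. R #>\<^bsub>FP\<^esub> a" using proj_hom by unfold_locales

lemma inl_closed [simp]: "x \<in> carrier H \<Longrightarrow> fp_inl H H x \<in> carrier FP"
  using hom_in_carrier[OF fp_inl_hom[OF H.is_group H.is_group]] .

lemma inr_closed [simp]: "x \<in> carrier H \<Longrightarrow> fp_inr H H x \<in> carrier FP"
  using hom_in_carrier[OF fp_inr_hom[OF H.is_group H.is_group]] .

lemma left_right_commute:
  assumes "x \<in> carrier H"
  shows "left x \<otimes>\<^bsub>\<chi> H\<^esub> right x = right x \<otimes>\<^bsub>\<chi> H\<^esub> left x"
proof -
  let ?c = "group_commutator FP (fp_inl H H x) (fp_inr H H x)"
  have "?c \<in> R"
    using assms unfolding normal_closure_def weak_commutators_def by blast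
  then have "R #>\<^bsub>FP\<^esub> ?c = \<one>\<^bsub>\<chi> H\<^esub>"
    using R.rcos_const[OF FP.is_group] by (simp add: weak_commutativity_group_def)
  then have "inv\<^bsub>\<chi> H\<^esub> left x \<otimes>\<^bsub>\<chi> H\<^esub> inv\<^bsub>\<chi> H\<^esub> right x \<otimes>\<^bsub>\<chi> H\<^esub> left x \<otimes>\<^bsub>\<chi> H\<^esub> right x = \<one>\<^bsub>\<chi> H\<^esub>"
    using assms by (simp add: group_commutator_def left_def right_def)
  then have "right x \<otimes>\<^bsub>\<chi> H\<^esub> left x \<otimes>\<^bsub>\<chi> H\<^esub> (inv\<^bsub>\<chi> H\<^esub> left x \<otimes>\<^bsub>\<chi> H\<^esub> inv\<^bsub>\<chi> H\<^esub> right x \<otimes>\<^bsub>\<chi> H\<^esub> left x \<otimes>\<^bsub>\<chi> H\<^esub> right x)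
      = right x \<otimes>\<^bsub>\<chi> H\<^esub> left x"
    using assms by simp
  then show ?thesis using assms by (simp add: \<chi>.word_simps)
qed

lemma generate_left_right: "generate (\<chi> H) (left ` carrier H \<union> right ` carrier H) = carrier (\<chi> H)"
proof
  let ?G = "generate (\<chi> H) (left ` carrier H \<union> right ` carrier H)"
  show "?G \<subseteq> carrier (\<chi> H)" by (rule \<chi>.generate_incl) auto
  have "R #>\<^bsub>FP\<^esub> fp_class H H w \<in> ?G" if "w \<in> fp_words H H" for w
    using that
  proof (induction w)
    case Nil
    have "R #>\<^bsub>FP\<^esub> fp_class H H [] = \<one>\<^bsub>\<chi> H\<^esub>" using proj.hom_one by (simp add: fp_one)
    then show ?case using generate.one by metis
  next
    case (Cons a w)
    then have w: "w \<in> fp_words H H" and a: "[a] \<in> fp_words H H" by auto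
    have "R #>\<^bsub>FP\<^esub> fp_class H H [a] \<in> ?G"
    proof (rule generate.incl)
      show "R #>\<^bsub>FP\<^esub> fp_class H H [a] \<in> left ` carrier H \<union> right ` carrier H"
        using a by (auto simp: left_def right_def fp_inl_def fp_inr_def)
    qed
    from generate.eng[OF this Cons.IH] w
    have "(R #>\<^bsub>FP\<^esub> fp_class H H [a]) \<otimes>\<^bsub>\<chi> H\<^esub> (R #>\<^bsub>FP\<^esub> fp_class H H w) \<in> ?G" by simp
    moreover have "R #>\<^bsub>FP\<^esub> fp_class H H (a # w)
      = (R #>\<^bsub>FP\<^esub> fp_class H H [a]) \<otimes>\<^bsub>\<chi> H\<^esub> (R #>\<^bsub>FP\<^esub> fp_class H H w)"
      using fp_mult_class[OF H.is_group H.is_group a w] proj.hom_mult[of "fp_class H H [a]" "fp_class H H w"]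
        fp_class_in_carrier[OF a] fp_class_in_carrier[OF w]
      by simp
    ultimately show ?case by simp
  qed
  then show "carrier (\<chi> H) \<subseteq> ?G"
    by (auto simp: weak_commutativity_group_def carrier_FactGroup elim!: fp_carrierE)
qed

text \<open>The universal property of the free product, and the fact that the kernel of the resulting map
  is a normal subgroup that contains the defining commutators.\<close>
lemma universal:
  fixes L :: "('c, 'd) monoid_scheme"
  assumes L: "group L" and f: "f \<in> hom H L" and g: "g \<in> hom H L"
    and comm: "\<And>x. x \<in> carrier H \<Longrightarrow> f x \<otimes>\<^bsub>L\<^esub> g x = g x \<otimes>\<^bsub>L\<^esub> f x"
  shows "\<exists>\<phi>\<in>hom (\<chi> H) L. \<forall>x\<in>carrier H. \<phi> (left x) = f x \<and> \<phi> (right x) = g x"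
proof -
  interpret L: group L by (rule L)
  interpret f: group_hom H L f using f by unfold_locales
  interpret g: group_hom H L g using g by unfold_locales
  obtain \<psi> where \<psi>: "\<psi> \<in> hom FP L"
    and \<psi>l: "\<And>x. x \<in> carrier H \<Longrightarrow> \<psi> (fp_inl H H x) = f x"
    and \<psi>r: "\<And>x. x \<in> carrier H \<Longrightarrow> \<psi> (fp_inr H H x) = g x"
    using free_product_universal[OF H.is_group H.is_group L f g] by blast
  interpret \<psi>: group_hom FP L \<psi> using \<psi> by unfold_locales
  have "weak_commutators H \<subseteq> kernel FP L \<psi>"
  proof
    fix c assume "c \<in> weak_commutators H"
    then obtain x where x: "x \<in> carrier H" "c = group_commutator FP (fp_inl H H x) (fp_inr H H x)"
      by (auto simp: weak_commutators_def)
    have "\<psi> c = inv\<^bsub>L\<^esub> (g x \<otimes>\<^bsub>L\<^esub> f x) \<otimes>\<^bsub>L\<^esub> (f x \<otimes>\<^bsub>L\<^esub> g x)"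
      using x by (simp add: group_commutator_def \<psi>l \<psi>r L.word_simps)
    also have "\<dots> = \<one>\<^bsub>L\<^esub>" using x(1) comm by simp
    finally show "c \<in> kernel FP L \<psi>" using x by (simp add: kernel_def group_commutator_def)
  qed
  then have sub: "R \<subseteq> kernel FP L \<psi>"
    using \<psi>.normal_kernel unfolding normal_closure_def by blast
  obtain \<phi> where \<phi>: "\<phi> \<in> hom (FP Mod R) L" "\<And>x. x \<in> carrier FP \<Longrightarrow> \<phi> (R #>\<^bsub>FP\<^esub> x) = \<psi> x"
    using \<psi>.FactGroup_universal_kernel[OF R.normal_axioms sub] by blast
  then show ?thesis
    by (intro bexI[of _ \<phi>]) (auto simp: left_def right_def \<psi>l \<psi>r weak_commutativity_group_def)
qed

lemma weakly_commuting_copies: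
  "\<exists>p q r. weakly_commuting_copies H (\<chi> H) left right p q r"
proof -
  have id: "(\<lambda>x. x) \<in> hom H H" and triv: "(\<lambda>x. \<one>\<^bsub>H\<^esub>) \<in> hom H H" by (auto simp: hom_def)
  obtain p where p: "p \<in> hom (\<chi> H) H" "\<forall>x\<in>carrier H. p (left x) = x \<and> p (right x) = \<one>\<^bsub>H\<^esub>"
    using universal[OF H.is_group id triv] by auto
  obtain q where q: "q \<in> hom (\<chi> H) H" "\<forall>x\<in>carrier H. q (left x) = \<one>\<^bsub>H\<^esub> \<and> q (right x) = x"
    using universal[OF H.is_group triv id] by auto
  obtain r where r: "r \<in> hom (\<chi> H) H" "\<forall>x\<in>carrier H. r (left x) = x \<and> r (right x) = x"
    using universal[OF H.is_group id id] by auto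
  have "weakly_commuting_copies H (\<chi> H) left right p q r"
    by unfold_locales
      (use p q r left_hom right_hom left_right_commute generate_left_right in auto)
  then show ?thesis by blast
qed

end

theorem theorem2:
  fixes H :: "('a, 'b) monoid_scheme"
  assumes "group H"
  shows "(polycyclic H \<longrightarrow> polycyclic (\<chi> H)) \<and>
         (polycyclic_by_finite H \<longrightarrow> polycyclic_by_finite (\<chi> H))"
proof -
  interpret weak_commutativity H by (rule weak_commutativity.intro[OF assms])
  obtain p q r where "weakly_commuting_copies H (\<chi> H) left right p q r"
    using weakly_commuting_copies by blast
  then interpret copies: weakly_commuting_copies H "\<chi> H" left right p q r .
  have "polycyclic (\<chi> H)" if "polycyclic H"
  proof -
    have ser: "cyclic_series H {\<one>\<^bsub>H\<^esub>} (carrier H)"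
      using that H.polycyclic_seq_iff_cyclic_series by (simp add: polycyclic_def)
    have "rcosets\<^bsub>H\<^esub> (carrier H) \<subseteq> {carrier H}"
      using H.coset_join2[OF _ H.subgroup_self] by (auto simp: RCOSETS_def)
    then have "finite (rcosets\<^bsub>H\<^esub> (carrier H))" by (rule finite_subset) simp
    note ser\<^sub>\<chi> = copies.polycyclic_finite_index(2)[OF H.normal_self ser this]
    have "{g \<in> carrier (\<chi> H). p g \<in> carrier H \<and> q g \<in> carrier H \<and> r g \<in> carrier H} = carrier (\<chi> H)"
      by auto
    with ser\<^sub>\<chi> have "cyclic_series (\<chi> H) {\<one>\<^bsub>\<chi> H\<^esub>} (carrier (\<chi> H))" by simp
    then show ?thesis
      using \<chi>.polycyclic_seq_iff_cyclic_series \<chi>.is_group by (simp add: polycyclic_def)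
  qed
  moreover have "polycyclic_by_finite (\<chi> H)" if "polycyclic_by_finite H"
  proof -
    obtain P where P: "P \<lhd> H" "polycyclic (H\<lparr>carrier := P\<rparr>)" "finite (rcosets\<^bsub>H\<^esub> P)"
      using \<open>polycyclic_by_finite H\<close> unfolding polycyclic_by_finite_def by blast
    have "cyclic_series H {\<one>\<^bsub>H\<^esub>} P"
      using P(2) H.polycyclic_subgroup_iff[OF normal_imp_subgroup[OF P(1)]] by simp
    note N = copies.polycyclic_finite_index[OF P(1) this P(3)]
    show ?thesis
      unfolding polycyclic_by_finite_def
      using N \<chi>.polycyclic_subgroup_iff[OF normal_imp_subgroup[OF N(1)]] \<chi>.is_group by blast
  qed
  ultimately show ?thesis by blast
qed

end
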